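(* Let $p\ge 5$ be a prime. (a) $\#\,\mathrm{Ell}^+(p)=2$ if $p\equiv 1 \pmod{12}$; $\#\,\mathrm{Ell}^+(p)=1$ if $p\equiv 5,7\pmod{12}$; $\#\,\mathrm{Ell}^+(p)=0$ if $p\equiv 11\pmod{12}$. (b) There is a one-to-one correspondence between $\mathrm{Ell}^-(p)$ and the set of all reduced (not necessarily primitive) positive definite integral binary quadratic forms of discriminant $-4p$.
   Context: For a positive integer $N$ let $R(N)^+=\left\{\begin{pmatrix} a & b\sqrt N\\ c\sqrt N & d\end{pmatrix}\in \mathrm{SL}_2(\mathbb R): a,b,c,d\in\mathbb Z\right\}$, $R(N)^-=\left\{\begin{pmatrix} a\sqrt N & b\\ c & d\sqrt N\end{pmatrix}\in \mathrm{SL}_2(\mathbb R): a,b,c,d\in\mathbb Z\right\}$, and $R(N)=R(N)^+\cup R(N)^-$, a discrete subgroup of $\mathrm{SL}_2(\mathbb R)$ acting on the upper half plane $\mathbb H$ by linear fractional transformations. A point $z\in\mathbb H$ is an elliptic point for $R(N)$ if its stabilizer $R(N)_z$ contains an element other than $\pm I$ (such an element is called elliptic). $\mathrm{Ell}^-(N)$ is the set of $R(N)$-equivalence classes of points of $\mathbb H$ that are stabilized by some elliptic element lying in $R(N)^-$. $\mathrm{Ell}^+(N)$ is the complement of $\mathrm{Ell}^-(N)$ in the set of all $R(N)$-equivalence classes of elliptic points for $R(N)$. A positive definite form $AX^2+BXY+CY^2$ with $A,B,C\in\mathbb Z$ and discriminant $B^2-4AC$ is reduced if $|B|\le A\le C$,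 and $B\ge 0$ whenever $|B|=A$ or $A=C$. *)

theory Defs
  imports "HOL-Analysis.Analysis" "HOL-Number_Theory.Cong" "HOL-Computational_Algebra.Primes"
begin

definition mat2 :: "real \<Rightarrow> real \<Rightarrow> real \<Rightarrow> real \<Rightarrow> real^2^2" where
  "mat2 a b c d = vector [vector [a, b], vector [c, d]]"

definition R_plus :: "nat \<Rightarrow> (real^2^2) set" where
  "R_plus N = {M. det M = 1 \<and> (\<exists>a b c d :: int.
     M = mat2 (of_int a) (of_int b * sqrt (real N))
              (of_int c * sqrt (real N)) (of_int d))}"

definition R_minus :: "nat \<Rightarrow> (real^2^2) set" where
  "R_minus N = {M. det M = 1 \<and> (\<exists>a b c d :: int.
     M = mat2 (of_int a * sqrt (real N)) (of_int b)
              (of_int c) (of_int d * sqrt (real N)))}"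

definition R_group :: "nat \<Rightarrow> (real^2^2) set" where
  "R_group N = R_plus N \<union> R_minus N"

definition upper_half_plane :: "complex set" where
  "upper_half_plane = {z. Im z > 0}"

definition lin_frac :: "real^2^2 \<Rightarrow> complex \<Rightarrow> complex" where
  "lin_frac M z = (of_real (M $ 1 $ 1) * z + of_real (M $ 1 $ 2)) /
                  (of_real (M $ 2 $ 1) * z + of_real (M $ 2 $ 2))"

definition R_equiv :: "nat \<Rightarrow> (complex \<times> complex) set" where
  "R_equiv N = {(z, w). z \<in> upper_half_plane \<and> w \<in> upper_half_plane \<and>
     (\<exists>M\<in>R_group N. w = lin_frac M z)}"

definition R_stabilizer :: "nat \<Rightarrow> complex \<Rightarrow> (real^2^2) set" where
  "R_stabilizer N z = {M \<in> R_group N. lin_frac M z = z}"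

definition elliptic_elements :: "nat \<Rightarrow> (real^2^2) set" where
  "elliptic_elements N =
     (\<Union>z\<in>upper_half_plane. R_stabilizer N z) - {mat 1, - mat 1}"

definition elliptic_points :: "nat \<Rightarrow> complex set" where
  "elliptic_points N =
     {z \<in> upper_half_plane. R_stabilizer N z \<inter> elliptic_elements N \<noteq> {}}"

text \<open>For a set \<open>A\<close> of points, \<open>A // R_equiv N\<close> is the set of the full
  equivalence classes in the upper half plane of the elements of \<open>A\<close>.\<close>

definition Ell :: "nat \<Rightarrow> complex set set" where
  "Ell N = elliptic_points N // R_equiv N"

definition Ell_minus :: "nat \<Rightarrow> complex set set" where
  "Ell_minus N = {z \<in> upper_half_plane.
     \<exists>M \<in> elliptic_elements N \<inter> R_minus N. M \<in> R_stabilizer N z} // R_equiv N"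

definition Ell_plus :: "nat \<Rightarrow> complex set set" where
  "Ell_plus N = Ell N - Ell_minus N"

text \<open>A triple \<open>(A, B, C)\<close> of integers stands for the binary quadratic form
  \<open>A X\<^sup>2 + B X Y + C Y\<^sup>2\<close>.\<close>

type_synonym int_bqf = "int \<times> int \<times> int"

fun pos_def_form :: "int_bqf \<Rightarrow> bool" where
  "pos_def_form (A, B, C) \<longleftrightarrow> (\<forall>x y :: real. (x, y) \<noteq> (0, 0) \<longrightarrow>
     of_int A * x\<^sup>2 + of_int B * x * y + of_int C * y\<^sup>2 > 0)"

fun form_discriminant :: "int_bqf \<Rightarrow> int" where
  "form_discriminant (A, B, C) = B\<^sup>2 - 4 * A * C"

fun reduced_form :: "int_bqf \<Rightarrow> bool" where
  "reduced_form (A, B, C) \<longleftrightarrow> \<bar>B\<bar> \<le> A \<and> A \<le> C \<and> (\<bar>B\<bar> = A \<or> A = C \<longrightarrow> B \<ge> 0)"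

definition reduced_forms_of_disc :: "int \<Rightarrow> int_bqf set" where
  "reduced_forms_of_disc D =
     {Q. pos_def_form Q \<and> reduced_form Q \<and> form_discriminant Q = D}"

end

theory Submission
  imports Defs "HOL-Number_Theory.Quadratic_Reciprocity"
begin

text \<open>
  In the coordinate \<open>w = z / sqrt p\<close> the group \<open>R(p)\<^sup>+\<close> becomes \<open>\<Gamma>\<^sub>0(p)\<close>, and every elliptic
  point is the root of a positive definite form \<open>(A, B, C)\<close> with \<open>p\<close> dividing \<open>A\<close> (a Heegner
  point), of discriminant \<open>- 3\<close> or \<open>- 4\<close> for elliptic elements in \<open>R(p)\<^sup>+\<close> and \<open>- 4 p\<close> for those in
  \<open>R(p)\<^sup>-\<close>.  When \<open>p\<^sup>2\<close> does not divide the discriminant, two such forms that are equivalent under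
  \<open>SL\<^sub>2(\<int>)\<close> and whose middle coefficients agree modulo \<open>p\<close> are already equivalent under
  \<open>\<Gamma>\<^sub>0(p)\<close>.

  For discriminants \<open>- 3\<close> and \<open>- 4\<close> the class number is one and \<open>B\<close> is determined modulo \<open>p\<close> up to
  sign; the Fricke involution \<open>z \<mapsto> - 1 / z\<close> switches the sign, so there is at most one
  \<open>R(p)\<close>-class, and there is one iff the discriminant is a square modulo \<open>p\<close>.  For
  discriminant \<open>- 4 p\<close> always \<open>p\<close> divides \<open>B\<close>, every form is equivalent to one with \<open>p\<close> dividing
  \<open>A\<close>, and composing with a stabilizing element of \<open>R(p)\<^sup>-\<close> shows that \<open>R(p)\<close>-classes and
  \<open>R(p)\<^sup>+\<close>-classes coincide; so the classes correspond to \<open>SL\<^sub>2(\<int>)\<close>-classes of forms,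
  hence to reduced forms.
\<close>

section \<open>Minus one and minus three as squares modulo a prime\<close>

text \<open>The only nonzero square modulo 3 is 1. This is the symbol that reciprocity will exchange
  for the symbol of 3 modulo p.\<close>

lemma legendre_prime_3:
  fixes p :: nat
  assumes "prime p" "p \<noteq> 3"
  shows "Legendre (int p) 3 = (if [p = 1] (mod 3) then 1 else - 1)"
proof -
  have n3: "\<not> 3 dvd p"
    using assms primes_dvd_imp_eq[of 3 p] by auto
  then have "p mod 3 = 1 \<or> p mod 3 = 2" by presburger
  moreover have "\<not> [int p = 0] (mod 3)"
    using n3 by (simp add: cong_0_iff) presburger
  moreover have "QuadRes 3 (int p)" if "p mod 3 = 1"
    using that unfolding QuadRes_def cong_def
    by (intro exI[of _ 1]) (simp, presburger)
  moreover have "\<not> QuadRes 3 (int p)" if "p mod 3 = 2"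
  proof
    assume "QuadRes 3 (int p)"
    then obtain y where "y\<^sup>2 mod 3 = int p mod 3"
      unfolding QuadRes_def cong_def by auto
    moreover have "int p mod 3 = 2" using that by presburger
    moreover have "y mod 3 = 0 \<or> y mod 3 = 1 \<or> y mod 3 = 2" by presburger
    moreover have "y\<^sup>2 mod 3 = (y mod 3)\<^sup>2 mod 3" by (simp add: power_mod)
    ultimately show False by auto
  qed
  ultimately show ?thesis
    unfolding Legendre_def cong_def by auto
qed

text \<open>Upgrades Euler's criterion from a congruence to an equality: a symbol and a sign differ
  by at most 2, so a difference divisible by \<open>p > 2\<close> vanishes.\<close>

lemma legendre_cong_unique:
  assumes "p > 2" "[Legendre a p = x] (mod p)" "x = 1 \<or> x = - 1"
  shows "Legendre a p = x"
proof -
  have "p dvd Legendre a p - x" using assms(2) by (simp add: cong_iff_dvd_diff)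
  moreover have "\<bar>Legendre a p - x\<bar> \<le> 2"
    using assms(3) unfolding Legendre_def by auto
  ultimately show ?thesis
    using assms(1) zdvd_not_zless[of "\<bar>Legendre a p - x\<bar>" p] by fastforce
qed

text \<open>By Euler's criterion the symbol of -1 is \<open>(- 1) ^ ((p - 1) div 2)\<close>, and
  this exponent is even exactly for p congruent to 1 modulo 4.\<close>

lemma square_eq_minus_one_mod_prime:
  fixes p :: nat
  assumes "prime p" "p \<ge> 5"
  shows "(\<exists>x. int p dvd x\<^sup>2 + 1) \<longleftrightarrow> [p = 1] (mod 4)"
proof -
  have odd: "odd p" using assms prime_odd_nat[of p] by auto
  have "[Legendre (- 1) p = (- 1) ^ ((p - 1) div 2)] (mod int p)"
    using euler_criterion[of p "- 1"] assms by auto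
  moreover have "(- 1) ^ ((p - 1) div 2) = (1::int) \<or> (- 1) ^ ((p - 1) div 2) = (- 1::int)"
    by (metis neg_one_even_power neg_one_odd_power)
  ultimately have L: "Legendre (- 1) p = (- 1) ^ ((p - 1) div 2)"
    using legendre_cong_unique[of "int p"] assms by auto
  have "even ((p - 1) div 2) \<longleftrightarrow> [p = 1] (mod 4)"
    using odd unfolding cong_def by presburger
  moreover have "Legendre (- 1) p = 1 \<longleftrightarrow> QuadRes (int p) (- 1)"
    using assms unfolding Legendre_def by (auto simp: cong_iff_dvd_diff)
  moreover have "Legendre (- 1) p = 1 \<longleftrightarrow> even ((p - 1) div 2)"
    unfolding L by (cases "even ((p - 1) div 2)") simp_all
  ultimately have "QuadRes (int p) (- 1) \<longleftrightarrow> [p = 1] (mod 4)" by metis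
  then show ?thesis unfolding QuadRes_def cong_iff_dvd_diff by simp
qed

text \<open>The reciprocity sign \<open>(- 1) ^ m\<close> is just what turns \<open>3 ^ m\<close>
  into \<open>(- 3) ^ m\<close>, so the symbol of -3 modulo p equals that of p modulo 3.\<close>

lemma square_eq_minus_three_mod_prime:
  fixes p :: nat
  assumes "prime p" "p \<ge> 5"
  shows "(\<exists>x. int p dvd x\<^sup>2 + 3) \<longleftrightarrow> [p = 1] (mod 3)"
proof -
  define m where "m = (p - 1) div 2"
  have n3: "\<not> int p dvd 3" using assms zdvd_not_zless[of 3 "int p"] by auto
  have "[Legendre 3 p = 3 ^ m] (mod int p)"
    using euler_criterion[of p 3] assms unfolding m_def by auto
  moreover have qr: "Legendre (int p) 3 * Legendre 3 p = (- 1) ^ m"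
    using Quadratic_Reciprocity[of p 3] assms unfolding m_def by auto
  \<comment> \<open>The symbol of 3 enters twice so that its square, which is 1, drops out.\<close>
  ultimately have "[Legendre (int p) 3 * Legendre 3 p * Legendre 3 p = (- 1) ^ m * 3 ^ m] (mod int p)"
    by (metis cong_scalar_left)
  moreover have "Legendre 3 p * Legendre 3 p = 1"
    using n3 unfolding Legendre_def by (auto simp: cong_0_iff)
  ultimately have "[Legendre (int p) 3 = (- 3) ^ m] (mod int p)"
    by (simp add: mult.assoc flip: power_mult_distrib)
  moreover have "[Legendre (- 3) p = (- 3) ^ m] (mod int p)"
    using euler_criterion[of p "- 3"] assms unfolding m_def by auto
  ultimately have "[Legendre (- 3) p = Legendre (int p) 3] (mod int p)"
    by (metis cong_sym cong_trans)
  then have L: "Legendre (- 3) p = (if [p = 1] (mod 3) then 1 else - 1)"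
    using legendre_cong_unique[of "int p"] legendre_prime_3[of p] assms by auto
  have "Legendre (- 3) p = 1 \<longleftrightarrow> QuadRes (int p) (- 3)"
    using n3 unfolding Legendre_def by (auto simp: cong_iff_dvd_diff)
  then show ?thesis
    using L unfolding QuadRes_def by (auto simp: cong_iff_dvd_diff split: if_splits)
qed

section \<open>Reduction of binary quadratic forms\<close>

text \<open>The substitution of \<open>r X + s Y\<close> for X and \<open>t X + u Y\<close> for Y.
  It is a right action: acting by a matrix M and then by M' is acting by the product of M and M', in
  this order.\<close>

fun bqf_act :: "int \<Rightarrow> int \<Rightarrow> int \<Rightarrow> int \<Rightarrow> int_bqf \<Rightarrow> int_bqf" where
  "bqf_act r s t u (A, B, C) =
     (A * r\<^sup>2 + B * r * t + C * t\<^sup>2,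
      2 * A * r * s + B * (r * u + s * t) + 2 * C * t * u,
      A * s\<^sup>2 + B * s * u + C * u\<^sup>2)"

definition bqf_equiv :: "int_bqf \<Rightarrow> int_bqf \<Rightarrow> bool" where
  "bqf_equiv Q Q' \<longleftrightarrow> (\<exists>r s t u. r * u - s * t = 1 \<and> Q' = bqf_act r s t u Q)"

lemma bqf_equivI: "r * u - s * t = 1 \<Longrightarrow> bqf_equiv Q (bqf_act r s t u Q)"
  unfolding bqf_equiv_def by blast

lemma bqf_equiv_refl: "bqf_equiv Q Q"
  using bqf_equivI[of 1 1 0 0 Q] by (cases Q) simp

lemma bqf_act_act:
  "bqf_act r' s' t' u' (bqf_act r s t u Q) =
     bqf_act (r * r' + s * t') (r * s' + s * u') (t * r' + u * t') (t * s' + u * u') Q"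
  by (cases Q) (simp add: power2_eq_square algebra_simps)

lemma bqf_equiv_trans:
  assumes "bqf_equiv P Q" "bqf_equiv Q R"
  shows "bqf_equiv P R"
proof -
  obtain r s t u where 1: "r * u - s * t = 1" "Q = bqf_act r s t u P"
    using assms(1) unfolding bqf_equiv_def by blast
  obtain r' s' t' u' where 2: "r' * u' - s' * t' = 1" "R = bqf_act r' s' t' u' Q"
    using assms(2) unfolding bqf_equiv_def by blast
  have "(r * r' + s * t') * (t * s' + u * u') - (r * s' + s * u') * (t * r' + u * t')
      = (r * u - s * t) * (r' * u' - s' * t')"
    by (simp add: algebra_simps)
  then have "(r * r' + s * t') * (t * s' + u * u') - (r * s' + s * u') * (t * r' + u * t') = 1"
    unfolding 1(1) 2(1) by simp
  then show ?thesis using bqf_equivI unfolding 1(2) 2(2) bqf_act_act by blast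
qed

lemma bqf_equiv_sym:
  assumes "bqf_equiv Q Q'"
  shows "bqf_equiv Q' Q"
proof -
  obtain r s t u where 1: "r * u - s * t = 1" "Q' = bqf_act r s t u Q"
    using assms unfolding bqf_equiv_def by blast
  \<comment> \<open>The inverse is the adjugate; its product with the matrix is the determinant
    times the identity.\<close>
  have "bqf_act u (- s) (- t) r Q' = bqf_act (r * u - s * t) 0 0 (r * u - s * t) Q"
    unfolding 1(2) bqf_act_act by (simp add: algebra_simps)
  then have "bqf_act u (- s) (- t) r Q' = Q"
    unfolding 1(1) by (cases Q) simp
  moreover have "u * r - (- s) * (- t) = 1" using 1(1) by (simp add: mult.commute)
  ultimately show ?thesis using bqf_equivI by metis
qed

lemma form_discriminant_act:
  "form_discriminant (bqf_act r s t u Q) = (r * u - s * t)\<^sup>2 * form_discriminant Q"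
  by (cases Q) (simp add: power2_eq_square algebra_simps)

lemma bqf_equiv_disc:
  assumes "bqf_equiv Q Q'"
  shows "form_discriminant Q' = form_discriminant Q"
  using assms unfolding bqf_equiv_def by (auto simp: form_discriminant_act simp del: form_discriminant.simps)

text \<open>Completing the square. The type is kept general because the lemma is applied both to
  integer values of a form and to real ones.\<close>

lemma bqf_value_pos:
  fixes A B C x y :: "'a :: linordered_idom"
  assumes "A > 0" "B\<^sup>2 - 4 * A * C < 0" "x \<noteq> 0 \<or> y \<noteq> 0"
  shows "A * x\<^sup>2 + B * x * y + C * y\<^sup>2 > 0"
proof -
  have eq: "4 * A * (A * x\<^sup>2 + B * x * y + C * y\<^sup>2) = (2 * A * x + B * y)\<^sup>2 + (4 * A * C - B\<^sup>2) * y\<^sup>2"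
    by (simp add: algebra_simps power2_eq_square)
  have "(2 * A * x + B * y)\<^sup>2 + (4 * A * C - B\<^sup>2) * y\<^sup>2 > 0"
  proof (cases "y = 0")
    case True
    then show ?thesis using assms by simp
  next
    case False
    then show ?thesis using assms by (intro add_nonneg_pos mult_pos_pos) auto
  qed
  then show ?thesis
    unfolding eq[symmetric] using assms(1) by (simp add: zero_less_mult_iff)
qed

lemma pos_def_form_iff: "pos_def_form (A, B, C) \<longleftrightarrow> A > 0 \<and> B\<^sup>2 - 4 * A * C < 0"
proof
  assume pd: "pos_def_form (A, B, C)"
  then have pd: "real_of_int A * x\<^sup>2 + B * x * y + C * y\<^sup>2 > 0" if "(x, y) \<noteq> (0, 0)" for x y
    using that by simp
  have A: "A > 0" using pd[of 1 0] by simp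
  \<comment> \<open>At \<open>(- B, 2 * A)\<close> the completed square vanishes, and the value is A
    times the negated discriminant.\<close>
  have "real_of_int A * (- B)\<^sup>2 + B * (- B) * (2 * A) + C * (2 * A)\<^sup>2 > 0"
    using pd[of "- B" "2 * A"] A by simp
  then have "real_of_int (A * (4 * A * C - B\<^sup>2)) > 0"
    by (simp add: algebra_simps power2_eq_square)
  then have "A * (4 * A * C - B\<^sup>2) > 0" by linarith
  then show "A > 0 \<and> B\<^sup>2 - 4 * A * C < 0" using A by (simp add: zero_less_mult_iff)
next
  assume *: "A > 0 \<and> B\<^sup>2 - 4 * A * C < 0"
  then have "real_of_int (B\<^sup>2 - 4 * A * C) < 0" by linarith
  then have "(real_of_int B)\<^sup>2 - 4 * real_of_int A * real_of_int C < 0" by simp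
  then show "pos_def_form (A, B, C)" using * bqf_value_pos[of "real_of_int A"] by auto
qed

lemma pos_def_form_equiv:
  assumes "bqf_equiv Q Q'" "pos_def_form Q"
  shows "pos_def_form Q'"
proof -
  obtain r s t u where 1: "r * u - s * t = 1" "Q' = bqf_act r s t u Q"
    using assms unfolding bqf_equiv_def by blast
  obtain A B C where Q: "Q = (A, B, C)" by (cases Q)
  obtain A' B' C' where Q': "Q' = (A', B', C')" by (cases Q')
  have pd: "A > 0" "B\<^sup>2 - 4 * A * C < 0"
    using assms(2) unfolding Q pos_def_form_iff by auto
  have "r \<noteq> 0 \<or> t \<noteq> 0" using 1(1) by auto
  then have "A' > 0" using bqf_value_pos[OF pd] 1(2) unfolding Q Q' by simp
  moreover have "B'\<^sup>2 - 4 * A' * C' < 0"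
    using bqf_equiv_disc[OF assms(1)] pd unfolding Q Q' by simp
  ultimately show ?thesis unfolding Q' pos_def_form_iff by simp
qed

section \<open>Gauss reduction of positive definite forms\<close>

lemma bqf_equiv_shift: "bqf_equiv (A, B, C) (A, B + 2 * A * k, A * k\<^sup>2 + B * k + C)"
  using bqf_equivI[of 1 1 k 0 "(A, B, C)"] by (simp add: algebra_simps)

lemma bqf_equiv_swap: "bqf_equiv (A, B, C) (C, - B, A)"
  using bqf_equivI[of 0 0 "- 1" 1 "(A, B, C)"] by simp

text \<open>Gauss's algorithm: a shift makes B small, and if then \<open>C < A\<close>, a swap
  lowers the leading coefficient, which is the measure of the induction.\<close>

lemma reduced_form_exists:
  assumes "pos_def_form Q"
  shows "\<exists>Q'. bqf_equiv Q Q' \<and> reduced_form Q'"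
  using assms
proof (induction "nat (fst Q)" arbitrary: Q rule: less_induct)
  case less
  obtain A B0 C0 where Q: "Q = (A, B0, C0)" by (cases Q)
  have A: "A > 0" using less.prems unfolding Q pos_def_form_iff by simp
  \<comment> \<open>The offset \<open>A - 1\<close> places the shifted B in the half-open range from
    \<open>- A + 1\<close> to A, so the forbidden boundary value \<open>- A\<close> never
    occurs.\<close>
  define k where "k = - ((B0 + A - 1) div (2 * A))"
  define B where "B = B0 + 2 * A * k"
  define C where "C = A * k\<^sup>2 + B0 * k + C0"
  have eq: "bqf_equiv Q (A, B, C)"
    unfolding Q B_def C_def by (rule bqf_equiv_shift)
  have "B = (B0 + A - 1) mod (2 * A) - A + 1"
    unfolding B_def k_def by (simp add: minus_mult_div_eq_mod [symmetric] algebra_simps)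
  moreover have "0 \<le> (B0 + A - 1) mod (2 * A)" "(B0 + A - 1) mod (2 * A) < 2 * A"
    using A by auto
  ultimately have B: "- A < B" "B \<le> A" by linarith+
  have pd': "pos_def_form (C, - B, A)"
    by (rule pos_def_form_equiv[OF bqf_equiv_trans[OF eq bqf_equiv_swap] less.prems])
  then have C: "C > 0" unfolding pos_def_form_iff by simp
  have eq': "bqf_equiv Q (C, - B, A)"
    by (rule bqf_equiv_trans[OF eq bqf_equiv_swap])
  consider "C < A" | "A < C \<or> A = C \<and> B \<ge> 0" | "A = C \<and> B < 0" by linarith
  then show ?case
  proof cases
    case 1
    then have "nat (fst (C, - B, A)) < nat (fst Q)" using C unfolding Q by simp
    from less.hyps[OF this pd'] show ?thesis using eq' bqf_equiv_trans by blast
  next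
    case 2
    then have "reduced_form (A, B, C)" using B by auto
    then show ?thesis using eq by blast
  next
    case 3
    \<comment> \<open>On the boundary \<open>A = C\<close> the swap only flips the sign of
      B.\<close>
    then have "reduced_form (C, - B, A)" using B by auto
    then show ?thesis using eq' by blast
  qed
qed

text \<open>\<open>A'\<close> is the value of the first form at \<open>(r, t)\<close>. A reduced
  form takes values at most A only at very small arguments, so \<open>A' \<le> A\<close> leaves
  three cases for \<open>(r, t)\<close>, each settled by the boundary conventions.\<close>

lemma reduced_form_unique_aux:
  assumes "bqf_equiv (A, B, C) (A', B', C')" "pos_def_form (A, B, C)"
    and "reduced_form (A, B, C)" "reduced_form (A', B', C')" "A' \<le> A"
  shows "(A', B', C') = (A, B, C)"
proof -
  obtain r s t u where d: "r * u - s * t = 1" and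
    A': "A' = A * r\<^sup>2 + B * r * t + C * t\<^sup>2" and
    B': "B' = 2 * A * r * s + B * (r * u + s * t) + 2 * C * t * u"
    using assms(1) unfolding bqf_equiv_def by auto
  have disc: "B'\<^sup>2 - 4 * A' * C' = B\<^sup>2 - 4 * A * C"
    using bqf_equiv_disc[OF assms(1)] by simp
  have A: "A > 0" using assms(2) unfolding pos_def_form_iff by simp
  have red: "\<bar>B\<bar> \<le> A" "A \<le> C" "\<bar>B\<bar> = A \<or> A = C \<Longrightarrow> B \<ge> 0"
    and red': "\<bar>B'\<bar> \<le> A'" "A' \<le> C'" "\<bar>B'\<bar> = A' \<or> A' = C' \<Longrightarrow> B' \<ge> 0"
    using assms(3,4) by auto
  have C'_eq: "C' = C" if "A' = A" "\<bar>B'\<bar> = \<bar>B\<bar>"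
  proof -
    have "B'\<^sup>2 = B\<^sup>2" using that(2) by (metis power2_abs)
    then show ?thesis using disc that(1) A by simp
  qed
  \<comment> \<open>From \<open>\<bar>B\<bar> \<le> A \<le> C\<close> the value at
    \<open>(r, t)\<close> is at least A times
    \<open>r^2 - \<bar>r\<bar> \<bar>t\<bar> + t^2\<close>, so this last expression is at most
    1.\<close>
  have rt: "\<bar>r\<bar> \<le> 1 \<and> \<bar>t\<bar> \<le> 1"
  proof -
    have "- (B * r * t) \<le> A * (\<bar>r\<bar> * \<bar>t\<bar>)"
    proof -
      have "- (B * r * t) \<le> \<bar>B\<bar> * (\<bar>r\<bar> * \<bar>t\<bar>)"
        by (metis abs_le_D2 abs_mult mult.assoc order_refl)
      also have "\<dots> \<le> A * (\<bar>r\<bar> * \<bar>t\<bar>)" using red(1) by (intro mult_right_mono) auto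
      finally show ?thesis .
    qed
    moreover have "A * t\<^sup>2 \<le> C * t\<^sup>2" using red(2) by (intro mult_right_mono) auto
    ultimately have "A * (r\<^sup>2 - \<bar>r\<bar> * \<bar>t\<bar> + t\<^sup>2) \<le> A * 1"
      using A' assms(5) by (simp add: algebra_simps)
    then have *: "r\<^sup>2 - \<bar>r\<bar> * \<bar>t\<bar> + t\<^sup>2 \<le> 1" using A by (simp only: mult_le_cancel_left_pos)
    define R T where "R = \<bar>r\<bar>" and "T = \<bar>t\<bar>"
    have RT: "R \<ge> 0" "T \<ge> 0" "(R - T)\<^sup>2 + R * T \<le> 1"
      using * unfolding R_def T_def by (auto simp: power2_diff)
    have one: "R * T \<le> 1" using RT(3) zero_le_power2[of "R - T"] by linarith
    have "R \<le> 1" if "T = 0" using RT that power_mono[of 2 R 2] by (cases "R \<ge> 2") auto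
    moreover have "T \<le> 1" if "R = 0" using RT that power_mono[of 2 T 2] by (cases "T \<ge> 2") auto
    moreover have "R \<le> 1 \<and> T \<le> 1" if "R \<noteq> 0" "T \<noteq> 0"
    proof -
      have "R * 1 \<le> R * T" "1 * T \<le> R * T"
        using RT that by (auto intro!: mult_left_mono mult_right_mono)
      then show ?thesis using one by linarith
    qed
    ultimately show ?thesis unfolding R_def[symmetric] T_def[symmetric] by fastforce
  qed
  \<comment> \<open>When t or r vanishes, \<open>B' - B\<close> or \<open>B' + B\<close> is a
    multiple of \<open>2 * A\<close>, while \<open>\<bar>B\<bar>\<close> and
    \<open>\<bar>B'\<bar>\<close> are at most A; hence the multiplier is 0, 1 or -1.\<close>
  have small: "k = 0 \<or> k = 1 \<or> k = - 1" if "\<bar>2 * A * k\<bar> \<le> 2 * A" for k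
  proof -
    have "2 * A * \<bar>k\<bar> \<le> 2 * A * 1" using that A by (simp add: abs_mult)
    then have "\<bar>k\<bar> \<le> 1" using A by (simp only: mult_le_cancel_left_pos)
    then show ?thesis by linarith
  qed
  consider "t = 0" | "r = 0" | "\<bar>r\<bar> = 1" "\<bar>t\<bar> = 1" using rt by linarith
  then show ?thesis
  proof cases
    case 1
    then have ru: "r * u = 1" using d by simp
    then have "\<bar>r\<bar> = 1" using rt 1 by (metis abs_1 abs_mult abs_zmult_eq_1)
    then have "r\<^sup>2 = 1" by (metis one_power2 power2_abs)
    then have AA: "A' = A" using A' 1 by simp
    have BB: "B' = B + 2 * A * (r * s)" using B' 1 ru by (simp add: algebra_simps)
    have "\<bar>2 * A * (r * s)\<bar> \<le> 2 * A" using BB red(1) red'(1) AA by linarith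
    from small[OF this] have "B' = B" using BB red red' AA A by auto
    then show ?thesis using AA C'_eq by simp
  next
    case 2
    then have st: "s * t = - 1" using d by simp
    then have "\<bar>t\<bar> = 1" using rt 2 by (metis abs_1 abs_minus abs_mult abs_zmult_eq_1 mult.commute)
    then have "t\<^sup>2 = 1" by (metis one_power2 power2_abs)
    then have AC: "A' = C" using A' 2 by simp
    then have C: "C = A" using red(2) assms(5) by simp
    have B0: "B \<ge> 0" using red(3) C by simp
    have BB: "B' + B = 2 * A * (t * u)" using B' 2 st C by (simp add: algebra_simps)
    have "\<bar>2 * A * (t * u)\<bar> \<le> 2 * A" using BB red(1) red'(1) AC C by linarith
    from small[OF this] have "\<bar>B'\<bar> = \<bar>B\<bar>" using BB red red' AC C B0 A by auto
    moreover from this have "C' = C" using C'_eq AC C by simp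
    moreover from this have "B' \<ge> 0" using red'(3) AC C by simp
    ultimately show ?thesis using B0 AC C by simp
  next
    case 3
    \<comment> \<open>Now \<open>A'\<close> is \<open>A + C\<close> plus or minus B, hence at least
      C and so at least A; equality throughout gives \<open>A' = A = C = \<bar>B\<bar>\<close>, and
      the discriminant then fixes \<open>C'\<close> and \<open>B'\<close>.\<close>
    have rt1: "\<bar>r * t\<bar> = 1" using 3 by (simp add: abs_mult)
    have "r\<^sup>2 = 1" "t\<^sup>2 = 1" using 3 by (metis one_power2 power2_abs)+
    then have "A' = A + C + B * (r * t)" using A' by (simp add: algebra_simps)
    moreover have "\<bar>B * (r * t)\<bar> = \<bar>B\<bar>" using rt1 by (simp add: abs_mult[of B])
    ultimately have e: "A' = A" "C = A" "\<bar>B\<bar> = A"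
      using red(1,2) assms(5) by linarith+
    then have BA: "B = A" using red(3) by simp
    have B'2: "B'\<^sup>2 \<le> A\<^sup>2" using red'(1) e(1) A by (metis power2_abs power_mono abs_ge_zero)
    have "B'\<^sup>2 - 4 * A * C' = A\<^sup>2 - 4 * A * A" using disc e BA by simp
    then have eq: "4 * A * C' = 4 * A * A + (B'\<^sup>2 - A\<^sup>2)" by simp
    then have "A * C' \<le> A * A" using B'2 by linarith
    then have "C' \<le> A" using A by simp
    then have CA: "C' = A" using red'(2) e(1) by simp
    then have "B'\<^sup>2 = A\<^sup>2" using eq by simp
    then have "\<bar>B'\<bar> = A" using A by (simp add: power2_eq_iff abs_if) linarith
    then have "B' = A" using red'(3) e(1) by simp
    then show ?thesis using e BA CA by simp
  qed
qed

lemma reduced_form_unique: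
  assumes "bqf_equiv Q Q'" "pos_def_form Q" "reduced_form Q" "reduced_form Q'"
  shows "Q' = Q"
proof -
  obtain A B C where Q: "Q = (A, B, C)" by (cases Q)
  obtain A' B' C' where Q': "Q' = (A', B', C')" by (cases Q')
  show ?thesis
  proof (cases "A' \<le> A")
    case True
    then show ?thesis using reduced_form_unique_aux assms unfolding Q Q' by blast
  next
    case False
    then have "(A, B, C) = (A', B', C')"
      using reduced_form_unique_aux[of A' B' C' A B C] assms(3,4)
        bqf_equiv_sym[OF assms(1)] pos_def_form_equiv[OF assms(1,2)]
      unfolding Q Q' by linarith
    then show ?thesis unfolding Q Q' by simp
  qed
qed

section \<open>The class number for discriminants -3 and -4\<close>

lemma reduced_form_leading_coeff_bound:
  assumes "reduced_form (A, B, C)"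
  shows "3 * A\<^sup>2 \<le> 4 * A * C - B\<^sup>2"
proof -
  have r: "\<bar>B\<bar> \<le> A" "A \<le> C" using assms by auto
  have "B\<^sup>2 \<le> A\<^sup>2" using r(1) by (metis abs_ge_zero power2_abs power_mono)
  moreover have "A * A \<le> A * C" using r by (intro mult_left_mono) auto
  ultimately show ?thesis by (simp add: power2_eq_square)
qed

text \<open>The bound on the leading coefficient gives \<open>A = 1\<close>, so B is 0, 1 or -1. The
  sign convention excludes -1, and the parity of D decides between 0 and 1; only the principal form
  \<open>Q0\<close> survives.\<close>

lemma class_number_one:
  assumes "D = - 3 \<or> D = - 4"
    and "pos_def_form Q" "form_discriminant Q = D"
    and "pos_def_form Q'" "form_discriminant Q' = D"
  shows "bqf_equiv Q Q'"
proof -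
  define Q0 where "Q0 = (if D = - 3 then (1, 1, 1) else (1, 0, 1) :: int_bqf)"
  have principal: "bqf_equiv Q Q0" if pd: "pos_def_form Q" and D: "form_discriminant Q = D" for Q
  proof -
    obtain R where R: "bqf_equiv Q R" "reduced_form R"
      using reduced_form_exists[OF pd] by blast
    obtain A B C where ABC: "R = (A, B, C)" by (cases R)
    have disc: "B\<^sup>2 - 4 * A * C = D" using bqf_equiv_disc[OF R(1)] D unfolding ABC by simp
    have A: "A > 0" using pos_def_form_equiv[OF R(1) pd] unfolding ABC pos_def_form_iff by simp
    have "3 * A\<^sup>2 \<le> 4" using reduced_form_leading_coeff_bound[of A B C] R(2) disc assms(1) unfolding ABC by auto
    then have A1: "A = 1" using A power_mono[of 2 A 2] by (cases "A \<ge> 2") auto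
    have "\<bar>B\<bar> \<le> 1" using R(2) A1 unfolding ABC by auto
    then consider "B = 0" | "B = 1" | "B = - 1" by linarith
    then have "R = Q0"
    proof cases
      case 1
      then show ?thesis using disc A1 assms(1) unfolding ABC Q0_def by (auto; presburger)
    next
      case 2
      then show ?thesis using disc A1 assms(1) unfolding ABC Q0_def by (auto; presburger)
    next
      case 3
      then show ?thesis using R(2) A1 unfolding ABC by auto
    qed
    then show ?thesis using R(1) by simp
  qed
  show ?thesis using principal assms bqf_equiv_sym bqf_equiv_trans by blast
qed

section \<open>The group and its action on the upper half plane\<close>

lemma mat2_nth [simp]:
  "mat2 a b c d $ 1 $ 1 = a" "mat2 a b c d $ 1 $ 2 = b"
  "mat2 a b c d $ 2 $ 1 = c" "mat2 a b c d $ 2 $ 2 = d"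
  by (simp_all add: mat2_def)

lemma det_mat2: "det (mat2 a b c d) = a * d - b * c"
  by (simp add: det_2)

lemma mat2_eq_iff: "mat2 a b c d = mat2 a' b' c' d' \<longleftrightarrow> a = a' \<and> b = b' \<and> c = c' \<and> d = d'"
  by (metis mat2_nth)

lemma mat2_mult:
  "mat2 a b c d ** mat2 a' b' c' d' =
     mat2 (a * a' + b * c') (a * b' + b * d') (c * a' + d * c') (c * b' + d * d')"
  by (simp add: vec_eq_iff forall_2 matrix_matrix_mult_def sum_2)

lemma mat_1_eq_mat2: "mat 1 = mat2 1 0 0 1"
  by (simp add: vec_eq_iff forall_2 mat_def)

lemma uminus_mat2: "- mat2 a b c d = mat2 (- a) (- b) (- c) (- d)"
  by (simp add: vec_eq_iff forall_2)

lemma lin_frac_mat2: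
  "lin_frac (mat2 a b c d) z = (of_real a * z + of_real b) / (of_real c * z + of_real d)"
  by (simp add: lin_frac_def)

lemma linear_nonzero_upper:
  assumes "Im z > 0" "c \<noteq> 0 \<or> d \<noteq> 0"
  shows "of_real c * z + of_real d \<noteq> 0"
  using assms by (auto simp: complex_eq_iff)

lemma lin_frac_mat2_mult:
  assumes "Im z > 0" "a' * d' - b' * c' = 1"
  shows "lin_frac (mat2 a b c d ** mat2 a' b' c' d') z =
    lin_frac (mat2 a b c d) (lin_frac (mat2 a' b' c' d') z)"
proof -
  define k where "k = of_real c' * z + of_real d'"
  define w where "w = lin_frac (mat2 a' b' c' d') z"
  have k: "k \<noteq> 0"
    unfolding k_def using assms by (intro linear_nonzero_upper) auto
  then have wk: "w * k = of_real a' * z + of_real b'"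
    unfolding w_def lin_frac_mat2 k_def by simp
  have "lin_frac (mat2 a b c d) w =
      ((of_real a * w + of_real b) * k) / ((of_real c * w + of_real d) * k)"
    using k by (simp add: lin_frac_mat2)
  also have "\<dots> = (of_real a * (w * k) + of_real b * k) / (of_real c * (w * k) + of_real d * k)"
    by (simp add: algebra_simps)
  also have "\<dots> = lin_frac (mat2 a b c d ** mat2 a' b' c' d') z"
    unfolding wk by (simp add: k_def mat2_mult lin_frac_mat2 algebra_simps)
  finally show ?thesis unfolding w_def by simp
qed

text \<open>The two factors \<open>sqrt N\<close> multiply to N, so the real determinant condition
  becomes an integer equation, to which divisibility arguments apply.\<close>

lemma R_plus_iff:
  "M \<in> R_plus N \<longleftrightarrow> (\<exists>a b c d :: int. a * d - int N * (b * c) = 1 \<and>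
     M = mat2 (of_int a) (of_int b * sqrt N) (of_int c * sqrt N) (of_int d))"
proof -
  have "real_of_int a * d - b * sqrt N * (c * sqrt N) = of_int (a * d - int N * (b * c))" for a b c d
    by (simp add: algebra_simps)
  then have "det (mat2 (of_int a) (of_int b * sqrt N) (of_int c * sqrt N) (of_int d)) = 1
      \<longleftrightarrow> a * d - int N * (b * c) = 1" for a b c d :: int
    unfolding det_mat2 by (metis of_int_eq_1_iff)
  then show ?thesis unfolding R_plus_def by blast
qed

lemma R_minus_iff:
  "M \<in> R_minus N \<longleftrightarrow> (\<exists>a b c d :: int. int N * (a * d) - b * c = 1 \<and>
     M = mat2 (of_int a * sqrt N) (of_int b) (of_int c) (of_int d * sqrt N))"
proof -
  have "real_of_int a * sqrt N * (d * sqrt N) - b * c = of_int (int N * (a * d) - b * c)" for a b c d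
    by (simp add: algebra_simps)
  then have "det (mat2 (of_int a * sqrt N) (of_int b) (of_int c) (of_int d * sqrt N)) = 1
      \<longleftrightarrow> int N * (a * d) - b * c = 1" for a b c d :: int
    unfolding det_mat2 by (metis of_int_eq_1_iff)
  then show ?thesis unfolding R_minus_def by blast
qed

lemma R_group_mat2:
  assumes "M \<in> R_group N"
  obtains a b c d where "M = mat2 a b c d" "a * d - b * c = 1"
proof -
  have "det M = 1" using assms unfolding R_group_def R_plus_def R_minus_def by auto
  moreover obtain a b c d where "M = mat2 a b c d"
    using assms unfolding R_group_def R_plus_def R_minus_def by blast
  ultimately show ?thesis using that det_mat2 by metis
qed

lemma lin_frac_mult:
  assumes "Im z > 0" "M \<in> R_group N" "M' \<in> R_group N"
  shows "lin_frac (M ** M') z = lin_frac M (lin_frac M' z)"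
  using assms lin_frac_mat2_mult R_group_mat2 by metis

text \<open>This and the next three lemmas show that the sign of group elements is multiplicative.
  Each writes down the integer entries of the product and obtains its determinant equation by
  multiplying the two given ones.\<close>

lemma R_plus_mult_plus:
  assumes "M \<in> R_plus N" "M' \<in> R_plus N"
  shows "M ** M' \<in> R_plus N"
proof -
  obtain a b c d where 1: "a * d - int N * (b * c) = 1"
    "M = mat2 (of_int a) (of_int b * sqrt N) (of_int c * sqrt N) (of_int d)"
    using assms(1) unfolding R_plus_iff by blast
  obtain a' b' c' d' where 2: "a' * d' - int N * (b' * c') = 1"
    "M' = mat2 (of_int a') (of_int b' * sqrt N) (of_int c' * sqrt N) (of_int d')"
    using assms(2) unfolding R_plus_iff by blast
  have "M ** M' = mat2 (of_int (a * a' + N * b * c')) (of_int (a * b' + b * d') * sqrt N)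
      (of_int (c * a' + d * c') * sqrt N) (of_int (N * c * b' + d * d'))"
    unfolding 1 2 mat2_mult mat2_eq_iff by (simp add: algebra_simps)
  moreover have "(a * a' + N * b * c') * (N * c * b' + d * d') - N * ((a * b' + b * d') * (c * a' + d * c'))
      = (a * d - int N * (b * c)) * (a' * d' - int N * (b' * c'))"
    by (simp add: algebra_simps)
  ultimately show ?thesis unfolding R_plus_iff 1(1) 2(1) by (metis mult_1)
qed

lemma R_minus_mult_minus:
  assumes "M \<in> R_minus N" "M' \<in> R_minus N"
  shows "M ** M' \<in> R_plus N"
proof -
  obtain a b c d where 1: "int N * (a * d) - b * c = 1"
    "M = mat2 (of_int a * sqrt N) (of_int b) (of_int c) (of_int d * sqrt N)"
    using assms(1) unfolding R_minus_iff by blast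
  obtain a' b' c' d' where 2: "int N * (a' * d') - b' * c' = 1"
    "M' = mat2 (of_int a' * sqrt N) (of_int b') (of_int c') (of_int d' * sqrt N)"
    using assms(2) unfolding R_minus_iff by blast
  have "M ** M' = mat2 (of_int (N * a * a' + b * c')) (of_int (a * b' + b * d') * sqrt N)
      (of_int (c * a' + d * c') * sqrt N) (of_int (c * b' + N * d * d'))"
    unfolding 1 2 mat2_mult mat2_eq_iff by (simp add: algebra_simps)
  moreover have "(N * a * a' + b * c') * (c * b' + N * d * d') - N * ((a * b' + b * d') * (c * a' + d * c'))
      = (int N * (a * d) - b * c) * (int N * (a' * d') - b' * c')"
    by (simp add: algebra_simps)
  ultimately show ?thesis unfolding R_plus_iff 1(1) 2(1) by (metis mult_1)
qed

lemma R_plus_mult_minus: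
  assumes "M \<in> R_plus N" "M' \<in> R_minus N"
  shows "M ** M' \<in> R_minus N"
proof -
  obtain a b c d where 1: "a * d - int N * (b * c) = 1"
    "M = mat2 (of_int a) (of_int b * sqrt N) (of_int c * sqrt N) (of_int d)"
    using assms(1) unfolding R_plus_iff by blast
  obtain a' b' c' d' where 2: "int N * (a' * d') - b' * c' = 1"
    "M' = mat2 (of_int a' * sqrt N) (of_int b') (of_int c') (of_int d' * sqrt N)"
    using assms(2) unfolding R_minus_iff by blast
  have "M ** M' = mat2 (of_int (a * a' + b * c') * sqrt N) (of_int (a * b' + N * b * d'))
      (of_int (N * c * a' + d * c')) (of_int (c * b' + d * d') * sqrt N)"
    unfolding 1 2 mat2_mult mat2_eq_iff by (simp add: algebra_simps)
  moreover have "N * ((a * a' + b * c') * (c * b' + d * d')) - (a * b' + N * b * d') * (N * c * a' + d * c')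
      = (a * d - int N * (b * c)) * (int N * (a' * d') - b' * c')"
    by (simp add: algebra_simps)
  ultimately show ?thesis unfolding R_minus_iff 1(1) 2(1) by (metis mult_1)
qed

lemma R_minus_mult_plus:
  assumes "M \<in> R_minus N" "M' \<in> R_plus N"
  shows "M ** M' \<in> R_minus N"
proof -
  obtain a b c d where 1: "int N * (a * d) - b * c = 1"
    "M = mat2 (of_int a * sqrt N) (of_int b) (of_int c) (of_int d * sqrt N)"
    using assms(1) unfolding R_minus_iff by blast
  obtain a' b' c' d' where 2: "a' * d' - int N * (b' * c') = 1"
    "M' = mat2 (of_int a') (of_int b' * sqrt N) (of_int c' * sqrt N) (of_int d')"
    using assms(2) unfolding R_plus_iff by blast
  have "M ** M' = mat2 (of_int (a * a' + b * c') * sqrt N) (of_int (N * a * b' + b * d'))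
      (of_int (c * a' + N * d * c')) (of_int (c * b' + d * d') * sqrt N)"
    unfolding 1 2 mat2_mult mat2_eq_iff by (simp add: algebra_simps)
  moreover have "N * ((a * a' + b * c') * (c * b' + d * d')) - (N * a * b' + b * d') * (c * a' + N * d * c')
      = (int N * (a * d) - b * c) * (a' * d' - int N * (b' * c'))"
    by (simp add: algebra_simps)
  ultimately show ?thesis unfolding R_minus_iff 1(1) 2(1) by (metis mult_1)
qed

lemma R_group_mult: "M \<in> R_group N \<Longrightarrow> M' \<in> R_group N \<Longrightarrow> M ** M' \<in> R_group N"
  unfolding R_group_def
  using R_plus_mult_plus R_minus_mult_minus R_plus_mult_minus R_minus_mult_plus by blast

lemma R_group_inverse:
  assumes "M \<in> R_group N"
  obtains M' where "M' \<in> R_group N" "M' ** M = mat 1"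
  using assms unfolding R_group_def
proof
  assume "M \<in> R_plus N"
  then obtain a b c d where 1: "a * d - int N * (b * c) = 1"
    "M = mat2 (of_int a) (of_int b * sqrt N) (of_int c * sqrt N) (of_int d)"
    unfolding R_plus_iff by blast
  define M' where "M' = mat2 (of_int d) (of_int (- b) * sqrt N) (of_int (- c) * sqrt N) (of_int a)"
  have "M' \<in> R_plus N"
    unfolding R_plus_iff M'_def using 1(1)
    by (intro exI[of _ d] exI[of _ "- b"] exI[of _ "- c"] exI[of _ a]) (simp add: algebra_simps)
  moreover have "real_of_int (a * d - int N * (b * c)) = 1" using 1(1) by simp
  then have "M' ** M = mat 1"
    unfolding M'_def 1(2) mat2_mult mat_1_eq_mat2 mat2_eq_iff by (simp add: algebra_simps)
  ultimately show ?thesis using that unfolding R_group_def by blast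
next
  assume "M \<in> R_minus N"
  then obtain a b c d where 1: "int N * (a * d) - b * c = 1"
    "M = mat2 (of_int a * sqrt N) (of_int b) (of_int c) (of_int d * sqrt N)"
    unfolding R_minus_iff by blast
  define M' where "M' = mat2 (of_int d * sqrt N) (of_int (- b)) (of_int (- c)) (of_int a * sqrt N)"
  have "M' \<in> R_minus N"
    unfolding R_minus_iff M'_def using 1(1)
    by (intro exI[of _ d] exI[of _ "- b"] exI[of _ "- c"] exI[of _ a]) (simp add: algebra_simps)
  moreover have "real_of_int (int N * (a * d) - b * c) = 1" using 1(1) by simp
  then have "M' ** M = mat 1"
    unfolding M'_def 1(2) mat2_mult mat_1_eq_mat2 mat2_eq_iff by (simp add: algebra_simps)
  ultimately show ?thesis using that unfolding R_group_def by blast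
qed

section \<open>The equivalence relation induced by the group\<close>

lemma lin_frac_mat_1: "lin_frac (mat 1) z = z"
  by (simp add: mat_1_eq_mat2 lin_frac_mat2)

lemma mat_1_in_R_plus: "mat 1 \<in> R_plus N"
  unfolding R_plus_iff mat_1_eq_mat2 mat2_eq_iff
  by (intro exI[of _ 1] exI[of _ 0]) simp

lemma equiv_R_equiv: "equiv upper_half_plane (R_equiv N)"
proof (rule equivI)
  show "R_equiv N \<subseteq> upper_half_plane \<times> upper_half_plane"
    unfolding R_equiv_def by auto
  show "refl_on upper_half_plane (R_equiv N)"
  proof (rule refl_onI)
    fix z assume "z \<in> upper_half_plane"
    moreover have "mat 1 \<in> R_group N" using mat_1_in_R_plus unfolding R_group_def by blast
    moreover have "z = lin_frac (mat 1) z" by (simp add: lin_frac_mat_1)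
    ultimately show "(z, z) \<in> R_equiv N" unfolding R_equiv_def by blast
  qed
  show "sym (R_equiv N)"
  proof (rule symI)
    fix z w assume "(z, w) \<in> R_equiv N"
    then obtain M where M: "Im z > 0" "Im w > 0" "M \<in> R_group N" "w = lin_frac M z"
      unfolding R_equiv_def upper_half_plane_def by auto
    obtain M' where M': "M' \<in> R_group N" "M' ** M = mat 1"
      using R_group_inverse[OF M(3)] .
    have "z = lin_frac M' w"
      using lin_frac_mult[OF M(1) M'(1) M(3)] M(4) M'(2) lin_frac_mat_1 by simp
    then show "(w, z) \<in> R_equiv N"
      using M M' unfolding R_equiv_def upper_half_plane_def by auto
  qed
  show "trans (R_equiv N)"
  proof (rule transI)
    fix x y z assume "(x, y) \<in> R_equiv N" "(y, z) \<in> R_equiv N"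
    then obtain M M' where *: "Im x > 0" "Im z > 0" "M \<in> R_group N" "M' \<in> R_group N"
      "y = lin_frac M x" "z = lin_frac M' y"
      unfolding R_equiv_def upper_half_plane_def by auto
    then have "z = lin_frac (M' ** M) x" using lin_frac_mult by metis
    then show "(x, z) \<in> R_equiv N"
      using * R_group_mult unfolding R_equiv_def upper_half_plane_def by auto
  qed
qed

section \<open>Heegner points\<close>

fun bqf_root :: "int_bqf \<Rightarrow> complex \<Rightarrow> bool" where
  "bqf_root (A, B, C) w \<longleftrightarrow> Im w > 0 \<and> of_int A * w\<^sup>2 + of_int B * w + of_int C = 0"

lemma bqf_root_Im_pos: "bqf_root Q w \<Longrightarrow> Im w > 0"
  by (cases Q) simp

text \<open>The quadratic formula without square roots: the imaginary part of the equation yields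
  \<open>Re w\<close>, and the real part, multiplied by \<open>4 * A\<close>, then yields the square
  of \<open>Im w\<close>.\<close>

lemma bqf_root_Re_Im:
  assumes "bqf_root (A, B, C) w"
  shows "2 * real_of_int A * Re w = - of_int B" "4 * (real_of_int A)\<^sup>2 * (Im w)\<^sup>2 = of_int (4 * A * C - B\<^sup>2)"
proof -
  have pos: "Im w > 0" and eq: "of_int A * w\<^sup>2 + of_int B * w + of_int C = 0"
    using assms by auto
  have "Im (of_int A * w\<^sup>2 + of_int B * w + of_int C) = Im w * (2 * A * Re w + B)"
    by (simp add: power2_eq_square algebra_simps)
  then have "Im w * (2 * A * Re w + B) = 0" unfolding eq by simp
  then show re: "2 * real_of_int A * Re w = - of_int B" using pos by simp
  have "Re (of_int A * w\<^sup>2 + of_int B * w + of_int C)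
      = A * ((Re w)\<^sup>2 - (Im w)\<^sup>2) + B * Re w + C"
    by (simp add: power2_eq_square)
  then have "A * ((Re w)\<^sup>2 - (Im w)\<^sup>2) + B * Re w + C = 0" unfolding eq by simp
  then have "0 = 4 * A * (A * ((Re w)\<^sup>2 - (Im w)\<^sup>2) + B * Re w + C)" by simp
  also have "4 * A * (A * ((Re w)\<^sup>2 - (Im w)\<^sup>2) + B * Re w + C)
      = (2 * real_of_int A * Re w)\<^sup>2 + 2 * B * (2 * real_of_int A * Re w) + 4 * A * C - 4 * (real_of_int A)\<^sup>2 * (Im w)\<^sup>2"
    by (simp add: power2_eq_square algebra_simps)
  finally show "4 * (real_of_int A)\<^sup>2 * (Im w)\<^sup>2 = of_int (4 * A * C - B\<^sup>2)"
    unfolding re by (simp add: power2_eq_square)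
qed

lemma bqf_root_disc_neg:
  assumes "bqf_root (A, B, C) w" "A \<noteq> 0"
  shows "B\<^sup>2 - 4 * A * C < 0"
proof -
  have "4 * (real_of_int A)\<^sup>2 * (Im w)\<^sup>2 > 0"
    using assms by simp
  then have "real_of_int (4 * A * C - B\<^sup>2) > 0"
    using bqf_root_Re_Im(2)[OF assms(1)] by simp
  then show ?thesis by linarith
qed

lemma bqf_root_exists:
  assumes "pos_def_form Q"
  shows "\<exists>w. bqf_root Q w"
proof -
  obtain A B C where Q: "Q = (A, B, C)" by (cases Q)
  have A: "A > 0" and D: "B\<^sup>2 - 4 * A * C < 0"
    using assms unfolding Q pos_def_form_iff by auto
  define d where "d = sqrt (of_int (4 * A * C - B\<^sup>2))"
  define w where "w = Complex (- B / (2 * A)) (d / (2 * A))"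
  have "real_of_int (4 * A * C - B\<^sup>2) > 0" using D by linarith
  then have d: "d > 0" "d\<^sup>2 = 4 * A * C - (real_of_int B)\<^sup>2" unfolding d_def by simp_all
  have C: "real_of_int C = (d\<^sup>2 + (real_of_int B)\<^sup>2) / (4 * A)"
    using A d(2) by (simp add: field_simps)
  have "A * ((B / (2 * A))\<^sup>2 - (d / (2 * A))\<^sup>2) - B * (B / (2 * A)) + C = 0"
    unfolding C using A by (simp add: field_simps power2_eq_square)
  then have "of_int A * w\<^sup>2 + of_int B * w + of_int C = 0"
    using A by (simp add: w_def complex_eq_iff power2_eq_square field_simps)
  then have "bqf_root Q w" unfolding Q using A d by (simp add: w_def)
  then show ?thesis ..
qed

lemma bqf_root_unique:
  assumes "bqf_root Q w" "bqf_root Q w'" "pos_def_form Q"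
  shows "w' = w"
proof -
  obtain A B C where Q: "Q = (A, B, C)" by (cases Q)
  have A: "A > 0" using assms(3) unfolding Q pos_def_form_iff by auto
  note w = bqf_root_Re_Im[OF assms(1)[unfolded Q]] and w' = bqf_root_Re_Im[OF assms(2)[unfolded Q]]
  have "2 * real_of_int A * Re w' = 2 * real_of_int A * Re w" unfolding w(1) w'(1) ..
  moreover have "4 * (real_of_int A)\<^sup>2 * (Im w')\<^sup>2 = 4 * (real_of_int A)\<^sup>2 * (Im w)\<^sup>2"
    unfolding w(2) w'(2) ..
  ultimately show ?thesis
    using A bqf_root_Im_pos[OF assms(1)] bqf_root_Im_pos[OF assms(2)]
    by (auto simp: complex_eq_iff power2_eq_iff)
qed

text \<open>Each discriminant is \<open>- 4 * (Im w)^2\<close> times the square of the leading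
  coefficient; eliminating \<open>Im w\<close> gives the identity. It identifies forms of equal
  discriminant and separates discriminants whose quotient is not a rational square.\<close>

lemma bqf_root_same_point:
  assumes "bqf_root (A, B, C) w" "bqf_root (A', B', C') w"
  shows "(B\<^sup>2 - 4 * A * C) * A'\<^sup>2 = (B'\<^sup>2 - 4 * A' * C') * A\<^sup>2"
proof -
  have "of_int ((4 * A * C - B\<^sup>2) * A'\<^sup>2) = 4 * (real_of_int A)\<^sup>2 * (Im w)\<^sup>2 * (real_of_int A')\<^sup>2"
    unfolding bqf_root_Re_Im(2)[OF assms(1)] by simp
  also have "\<dots> = 4 * (real_of_int A')\<^sup>2 * (Im w)\<^sup>2 * (real_of_int A)\<^sup>2" by simp
  also have "\<dots> = of_int ((4 * A' * C' - B'\<^sup>2) * A\<^sup>2)"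
    unfolding bqf_root_Re_Im(2)[OF assms(2)] by simp
  finally have "(4 * A * C - B\<^sup>2) * A'\<^sup>2 = (4 * A' * C' - B'\<^sup>2) * A\<^sup>2"
    unfolding of_int_eq_iff .
  then show ?thesis by (simp add: algebra_simps)
qed

lemma bqf_root_form_unique:
  assumes "bqf_root Q w" "bqf_root Q' w" "pos_def_form Q" "pos_def_form Q'"
    and "form_discriminant Q = form_discriminant Q'"
  shows "Q' = Q"
proof -
  obtain A B C where Q: "Q = (A, B, C)" by (cases Q)
  obtain A' B' C' where Q': "Q' = (A', B', C')" by (cases Q')
  have A: "A > 0" "A' > 0" and D: "B\<^sup>2 - 4 * A * C < 0"
    using assms unfolding Q Q' pos_def_form_iff by auto
  have D': "B'\<^sup>2 - 4 * A' * C' = B\<^sup>2 - 4 * A * C" using assms(5) unfolding Q Q' by simp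
  have "A'\<^sup>2 = A\<^sup>2"
    using bqf_root_same_point[of A B C w A' B' C'] assms(1,2) D unfolding Q Q' D' by auto
  then have AA: "A' = A" using A by (simp add: power2_eq_iff)
  have "real_of_int B' = B"
    using bqf_root_Re_Im(1)[OF assms(1)[unfolded Q]] bqf_root_Re_Im(1)[OF assms(2)[unfolded Q']]
    unfolding AA by linarith
  then have BB: "B' = B" by simp
  show ?thesis using D' A unfolding Q Q' AA BB by simp
qed

text \<open>Homogeneity of degree 2: multiplying by the squared denominator turns evaluation at the
  Moebius image v into the substituted form.\<close>

lemma bqf_act_eval:
  fixes r s t u :: int and w :: complex
  assumes "bqf_act r s t u (A, B, C) = (A', B', C')"
    and "of_int t * w + of_int u \<noteq> 0"
  defines "v \<equiv> (of_int r * w + of_int s) / (of_int t * w + of_int u)"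
  shows "of_int A' * w\<^sup>2 + of_int B' * w + of_int C' =
    (of_int A * v\<^sup>2 + of_int B * v + of_int C) * (of_int t * w + of_int u)\<^sup>2"
proof -
  define k where "k = of_int t * w + of_int u"
  have vk: "v * k = of_int r * w + of_int s" unfolding v_def k_def using assms(2) by simp
  have "(of_int A * v\<^sup>2 + of_int B * v + of_int C) * k\<^sup>2 =
      of_int A * (v * k)\<^sup>2 + of_int B * (v * k) * k + of_int C * k\<^sup>2"
    by (simp add: power2_eq_square algebra_simps)
  also have "\<dots> =
      of_int A * (of_int r * w + of_int s)\<^sup>2 + of_int B * (of_int r * w + of_int s) * k + of_int C * k\<^sup>2"
    unfolding vk ..
  also have "\<dots> = of_int A' * w\<^sup>2 + of_int B' * w + of_int C'"
    using assms(1) unfolding k_def by (auto simp: power2_eq_square algebra_simps)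
  finally show ?thesis unfolding k_def by simp
qed

text \<open>The imaginary part is divided by the squared modulus of the denominator and multiplied
  by the determinant, here 1.\<close>

lemma Im_moebius:
  fixes r s t u :: int
  assumes "r * u - s * t = 1" "Im w > 0"
  shows "Im ((of_int r * w + of_int s) / (of_int t * w + of_int u)) > 0"
proof -
  define k where "k = of_int t * w + of_int u"
  have "t \<noteq> 0 \<or> u \<noteq> 0" using assms(1) by auto
  then have "k \<noteq> 0"
    unfolding k_def using linear_nonzero_upper[OF assms(2), of "of_int t" "of_int u"] by simp
  then have k: "(Re k)\<^sup>2 + (Im k)\<^sup>2 > 0"
    by (metis complex_eq_iff sum_power2_gt_zero_iff zero_complex.simps)
  have "Im ((of_int r * w + of_int s) / k)
      = (r * Im w * Re k - (r * Re w + s) * Im k) / ((Re k)\<^sup>2 + (Im k)\<^sup>2)"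
    by (simp add: Im_divide)
  also have "r * Im w * Re k - (r * Re w + s) * Im k = real_of_int (r * u - s * t) * Im w"
    unfolding k_def by (simp add: algebra_simps)
  finally show ?thesis using assms k unfolding k_def[symmetric] by simp
qed

text \<open>Forms and points transform in opposite directions: the matrix that takes Q to the new
  form carries the root of the new form back to the root of Q.\<close>

lemma bqf_root_act_iff:
  fixes r s t u :: int
  assumes "r * u - s * t = 1" "Im w > 0"
  shows "bqf_root (bqf_act r s t u Q) w \<longleftrightarrow>
    bqf_root Q ((of_int r * w + of_int s) / (of_int t * w + of_int u))"
proof -
  obtain A B C where Q: "Q = (A, B, C)" by (cases Q)
  obtain A' B' C' where Q': "bqf_act r s t u (A, B, C) = (A', B', C')"
    by (metis prod_cases3)
  have "t \<noteq> 0 \<or> u \<noteq> 0" using assms(1) by auto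
  then have k: "of_int t * w + of_int u \<noteq> 0"
    using linear_nonzero_upper[OF assms(2), of "of_int t" "of_int u"] by simp
  show ?thesis
    unfolding Q Q' bqf_root.simps bqf_act_eval[OF Q' k]
    using Im_moebius[OF assms] assms(2) k by simp
qed

section \<open>Forms of level p and the action of Gamma_0(p)\<close>

definition heegner_form :: "nat \<Rightarrow> int \<Rightarrow> int_bqf \<Rightarrow> bool" where
  "heegner_form p D Q \<longleftrightarrow> pos_def_form Q \<and> form_discriminant Q = D \<and> int p dvd fst Q"

text \<open>The factor \<open>sqrt p\<close> returns from the coordinate w of the forms to the
  coordinate on which \<open>R_group p\<close> acts.\<close>

definition heegner_points :: "nat \<Rightarrow> int \<Rightarrow> complex set" where
  "heegner_points p D = {of_real (sqrt p) * w | Q w. heegner_form p D Q \<and> bqf_root Q w}"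

lemma heegner_formD:
  assumes "heegner_form p D (A, B, C)"
  shows "A > 0" "D < 0" "B\<^sup>2 - 4 * A * C = D" "int p dvd A"
  using assms pos_def_form_iff[of A B C] unfolding heegner_form_def by auto

text \<open>Fixed point equations produce leading coefficients of either sign; negating the whole
  form keeps its roots and its discriminant.\<close>

lemma heegner_pointsI:
  assumes "bqf_root (A, B, C) w" "A \<noteq> 0" "int p dvd A" "B\<^sup>2 - 4 * A * C = D"
  shows "of_real (sqrt p) * w \<in> heegner_points p D"
proof -
  have neg: "B\<^sup>2 - 4 * A * C < 0" using bqf_root_disc_neg[OF assms(1,2)] .
  have "\<exists>Q. heegner_form p D Q \<and> bqf_root Q w"
  proof (cases "A > 0")
    case True
    then show ?thesis
      using assms neg by (intro exI[of _ "(A, B, C)"]) (auto simp: heegner_form_def pos_def_form_iff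
          simp del: pos_def_form.simps)
  next
    case False
    have "of_int (- A) * w\<^sup>2 + of_int (- B) * w + of_int (- C) = - (of_int A * w\<^sup>2 + of_int B * w + of_int C)"
      by simp
    also have "\<dots> = 0" using assms(1) by simp
    finally have "bqf_root (- A, - B, - C) w" using assms(1) unfolding bqf_root.simps by blast
    then show ?thesis
      using assms(2-4) neg False
      by (intro exI[of _ "(- A, - B, - C)"]) (auto simp: heegner_form_def pos_def_form_iff
          simp del: pos_def_form.simps bqf_root.simps)
  qed
  then show ?thesis unfolding heegner_points_def by blast
qed

lemma heegner_points_upper: "z \<in> heegner_points p D \<Longrightarrow> p > 0 \<Longrightarrow> Im z > 0"
  unfolding heegner_points_def using bqf_root_Im_pos by auto

text \<open>Scaling by \<open>sqrt p\<close> cancels the square roots, so \<open>R_plus p\<close>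
  acts on w through integer matrices with lower left entry divisible by p, that is, through
  Gamma_0(p).\<close>

lemma lin_frac_plus_scaled:
  fixes a b c d :: int
  assumes "p > 0"
  shows "lin_frac (mat2 (of_int a) (of_int b * sqrt p) (of_int c * sqrt p) (of_int d)) (of_real (sqrt p) * w) =
    of_real (sqrt p) * ((of_int a * w + of_int b) / (of_int (int p * c) * w + of_int d))"
proof -
  have s: "of_real (sqrt p) * of_real (sqrt p) = (of_nat p :: complex)"
    by (metis abs_of_nat of_real_mult of_real_of_nat_eq real_sqrt_mult_self)
  have "of_real (of_int c * sqrt p) * (of_real (sqrt p) * w) =
      of_int c * (of_real (sqrt p) * of_real (sqrt p)) * w"
    by simp
  also have "\<dots> = of_int (int p * c) * w" unfolding s by simp
  finally have den: "of_real (of_int c * sqrt p) * (of_real (sqrt p) * w) = of_int (int p * c) * w" .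
  show ?thesis unfolding lin_frac_mat2 den by (simp add: algebra_simps add_divide_distrib)
qed

lemma scaled_upper_half_plane:
  fixes p :: nat
  assumes "Im z > 0" "p > 0"
  obtains w where "z = of_real (sqrt p) * w" "Im w > 0"
proof
  show "z = of_real (sqrt p) * (z / of_real (sqrt p))" using assms by simp
  show "Im (z / of_real (sqrt p)) > 0" using assms by simp
qed

text \<open>Pull Q back along M, which maps the point of \<open>w'\<close> to that of w. As p
  divides both A and the lower left entry, it divides the new leading coefficient.\<close>

lemma heegner_form_R_plus:
  assumes "p > 0" "heegner_form p D Q" "bqf_root Q w" "Im w' > 0" "M \<in> R_plus p"
    and "of_real (sqrt p) * w = lin_frac M (of_real (sqrt p) * w')"
  shows "\<exists>Q'. heegner_form p D Q' \<and> bqf_root Q' w' \<and> bqf_equiv Q Q'"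
proof -
  obtain A B C where Q: "Q = (A, B, C)" by (cases Q)
  obtain a b c d where 1: "a * d - int p * (b * c) = 1"
    "M = mat2 (of_int a) (of_int b * sqrt p) (of_int c * sqrt p) (of_int d)"
    using assms(5) unfolding R_plus_iff by blast
  have w: "w = (of_int a * w' + of_int b) / (of_int (int p * c) * w' + of_int d)"
    using assms(6) assms(1) unfolding 1(2) lin_frac_plus_scaled[OF assms(1)] mult_cancel_left by simp
  have det: "a * d - b * (int p * c) = 1" using 1(1) by (simp add: algebra_simps)
  define Q' where "Q' = bqf_act a b (int p * c) d Q"
  have "bqf_root Q' w'"
    unfolding Q'_def bqf_root_act_iff[OF det assms(4)] using assms(3) unfolding w .
  moreover have eq: "bqf_equiv Q Q'" unfolding Q'_def using bqf_equivI[OF det] .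
  moreover have "int p dvd A * a\<^sup>2 + B * a * (int p * c) + C * (int p * c)\<^sup>2"
    using assms(2) unfolding heegner_form_def Q
    by (intro dvd_add) (simp_all add: power2_eq_square)
  then have "heegner_form p D Q'"
    using pos_def_form_equiv[OF eq] bqf_equiv_disc[OF eq] assms(2)
    unfolding heegner_form_def by (simp add: Q'_def Q)
  ultimately show ?thesis by blast
qed

text \<open>This promotes SL_2-equivalence to Gamma_0(p)-equivalence. If p did not divide t, the
  conditions on \<open>A'\<close> and \<open>B'\<close> would force p to divide B and then C, and
  with \<open>p dvd A\<close> the square of p would divide the discriminant.\<close>

lemma lower_left_divisible:
  fixes p A B C A' B' C' r s t u :: int
  assumes "prime p" "p \<noteq> 2" "r * u - s * t = 1" "(A', B', C') = bqf_act r s t u (A, B, C)"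
    and "p dvd A" "p dvd A'" "p dvd B - B'" "\<not> p\<^sup>2 dvd B\<^sup>2 - 4 * A * C"
  shows "p dvd t"
proof (rule ccontr)
  assume t: "\<not> p dvd t"
  have p2: "\<not> p dvd 2"
    using assms(1,2) primes_dvd_imp_eq[of p 2] by auto
  \<comment> \<open>Grouped so that, modulo p, both \<open>A'\<close> and \<open>B' - B\<close> are
    multiples of t; the determinant 1 brings out the summand B of \<open>B'\<close>.\<close>
  have A': "A' = A * r\<^sup>2 + t * (B * r + C * t)"
    and B': "B' = B * (r * u - s * t) + 2 * A * r * s + 2 * t * (B * s + C * u)"
    using assms(4) by (auto simp: power2_eq_square algebra_simps)
  have "p dvd t * (B * r + C * t)"
    using assms(5,6) unfolding A' by (metis dvd_add_right_iff dvd_mult2)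
  then have 1: "p dvd B * r + C * t" using t assms(1) prime_dvd_mult_iff by blast
  have "p dvd - (B - B') - 2 * A * r * s"
    using assms(5,7) by (intro dvd_diff) (simp_all only: dvd_minus_iff dvd_mult dvd_mult2)
  also have "- (B - B') - 2 * A * r * s = 2 * (t * (B * s + C * u))"
    unfolding B' assms(3) by simp
  finally have 2: "p dvd B * s + C * u" using t p2 assms(1) prime_dvd_mult_iff by blast
  \<comment> \<open>Eliminates C from the two linear congruences by Cramer's rule.\<close>
  have "B * (r * u - s * t) = u * (B * r + C * t) - t * (B * s + C * u)"
    by (simp add: algebra_simps)
  also have "p dvd \<dots>" using 1 2 by (intro dvd_diff dvd_mult)
  finally have pB: "p dvd B" unfolding assms(3) by simp
  then have "p dvd C * t" using 1 by (metis dvd_add_right_iff dvd_mult2)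
  then have "p dvd C" using t assms(1) prime_dvd_mult_iff by blast
  then have "p\<^sup>2 dvd A * C" unfolding power2_eq_square using assms(5) by (intro mult_dvd_mono)
  moreover have "p\<^sup>2 dvd B\<^sup>2" using pB by simp
  ultimately have "p\<^sup>2 dvd B\<^sup>2 - 4 * A * C" by (simp add: mult.assoc)
  then show False using assms(8) by simp
qed

text \<open>By \<open>lower_left_divisible\<close> the matrix linking the forms has
  \<open>t = p * c\<close>, so it comes from an element of \<open>R_plus p\<close>; that element
  maps \<open>w'\<close> to w because roots move against forms.\<close>

lemma heegner_forms_R_equiv:
  assumes "prime p" "p \<noteq> 2" "\<not> (int p)\<^sup>2 dvd D"
    and "heegner_form p D (A, B, C)" "bqf_root (A, B, C) w"
    and "heegner_form p D (A', B', C')" "bqf_root (A', B', C') w'"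
    and "bqf_equiv (A, B, C) (A', B', C')" "int p dvd B - B'"
  shows "(of_real (sqrt p) * w', of_real (sqrt p) * w) \<in> R_equiv p"
proof -
  have p0: "p > 0" using assms(1) prime_gt_0_nat by blast
  obtain r s t u where 1: "r * u - s * t = 1" "(A', B', C') = bqf_act r s t u (A, B, C)"
    using assms(8) unfolding bqf_equiv_def by blast
  have "int p dvd t"
    using lower_left_divisible[OF _ _ 1] assms(1-3,9) heegner_formD[OF assms(4)] heegner_formD[OF assms(6)]
    by simp
  then obtain c where t: "t = int p * c" by (elim dvdE)
  define M where "M = mat2 (of_int r) (of_int s * sqrt p) (of_int c * sqrt p) (of_int u)"
  have Im: "Im w' > 0" "Im w > 0" using assms(5,7) by auto
  have "bqf_root (A, B, C) ((of_int r * w' + of_int s) / (of_int t * w' + of_int u))"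
    using assms(7) unfolding 1(2) bqf_root_act_iff[OF 1(1) Im(1)] .
  then have "w = (of_int r * w' + of_int s) / (of_int t * w' + of_int u)"
    using bqf_root_unique assms(4,5) unfolding heegner_form_def by blast
  then have "of_real (sqrt p) * w = lin_frac M (of_real (sqrt p) * w')"
    unfolding M_def lin_frac_plus_scaled[OF p0] t by simp
  moreover have "M \<in> R_plus p"
    unfolding R_plus_iff M_def using 1(1) unfolding t
    by (intro exI[of _ r] exI[of _ s] exI[of _ c] exI[of _ u]) (simp add: algebra_simps)
  moreover have "Im (of_real (sqrt p) * w') > 0" "Im (of_real (sqrt p) * w) > 0"
    using Im p0 by simp_all
  ultimately show ?thesis
    unfolding R_equiv_def upper_half_plane_def R_group_def by blast
qed

section \<open>The Fricke involution\<close>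

lemma fricke_in_R_minus: "mat2 0 (- 1) 1 0 \<in> R_minus N"
  unfolding R_minus_iff mat2_eq_iff by (intro exI[of _ 0] exI[of _ "- 1"] exI[of _ 1]) simp

lemma lin_frac_fricke: "lin_frac (mat2 0 (- 1) 1 0) z = - 1 / z"
  by (simp add: lin_frac_mat2)

text \<open>In the coordinate w the involution sends w to \<open>- 1 / (p * w)\<close>. Clearing
  denominators exchanges A and C and negates B, and the factor p stays in the leading
  coefficient.\<close>

lemma heegner_form_fricke:
  assumes "p > 0" "heegner_form p D (int p * A, B, C)" "bqf_root (int p * A, B, C) w"
  shows "heegner_form p D (int p * C, - B, A)"
    and "bqf_root (int p * C, - B, A) (- 1 / (of_nat p * w))"
    and "- 1 / (of_real (sqrt p) * w) = of_real (sqrt p) * (- 1 / (of_nat p * w))"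
proof -
  note D = heegner_formD[OF assms(2)]
  have A: "A > 0" using D(1) assms(1) by (simp add: zero_less_mult_iff)
  have "4 * (int p * A) * C > 0" using D(2,3) zero_le_power2[of B] by linarith
  then have "C > 0" using D(1) by (intro zero_less_mult_pos[of "4 * (int p * A)" C]) auto
  then show "heegner_form p D (int p * C, - B, A)"
    using D assms(1) unfolding heegner_form_def pos_def_form_iff by (auto simp: algebra_simps)
  have w: "Im w > 0" "of_nat p * of_int A * w\<^sup>2 + of_int B * w + of_int C = 0"
    using assms(3) by auto
  have w0: "w \<noteq> 0" using w(1) by auto
  have "Im (- 1 / (of_nat p * w)) = (p * Im w) / ((p * Re w)\<^sup>2 + (p * Im w)\<^sup>2)"
    by (simp add: Im_divide)
  moreover have "(p * Re w)\<^sup>2 + (p * Im w)\<^sup>2 > 0" using w(1) assms(1) by (simp add: add_nonneg_pos)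
  ultimately have "Im (- 1 / (of_nat p * w)) > 0" using w(1) assms(1) by simp
  moreover have "of_int (int p * C) * (- 1 / (of_nat p * w))\<^sup>2 + of_int (- B) * (- 1 / (of_nat p * w)) + of_int A
      = (of_nat p * of_int A * w\<^sup>2 + of_int B * w + of_int C) / (of_nat p * w\<^sup>2)"
    using w0 assms(1) by (simp add: field_simps power2_eq_square)
  ultimately show "bqf_root (int p * C, - B, A) (- 1 / (of_nat p * w))"
    unfolding w(2) by simp
  have s: "of_real (sqrt p) * of_real (sqrt p) = (of_nat p :: complex)"
    by (metis abs_of_nat of_real_mult of_real_of_nat_eq real_sqrt_mult_self)
  show "- 1 / (of_real (sqrt p) * w) = of_real (sqrt p) * (- 1 / (of_nat p * w))"
    using w0 assms(1) unfolding s[symmetric] by (simp add: field_simps)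
qed

text \<open>Every element of \<open>R_minus N\<close> is the Fricke matrix times an element of
  \<open>R_plus N\<close>, so invariance under the whole group reduces to \<open>R_plus N\<close>
  and the involution.\<close>

lemma R_minus_factor:
  assumes "M \<in> R_minus N" "Im z > 0"
  obtains M' where "M' \<in> R_plus N" "lin_frac M z = - 1 / lin_frac M' z"
proof
  define M' where "M' = mat2 0 1 (- 1) 0 ** M"
  have F: "mat2 0 1 (- 1) 0 \<in> R_minus N"
    unfolding R_minus_iff mat2_eq_iff by (intro exI[of _ 0] exI[of _ 1] exI[of _ "- 1"]) simp
  then show M': "M' \<in> R_plus N" unfolding M'_def using assms(1) R_minus_mult_minus by blast
  have "mat2 0 (- 1) 1 0 ** M' = M"
    unfolding M'_def matrix_mul_assoc mat2_mult by (simp flip: mat_1_eq_mat2)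
  then show "lin_frac M z = - 1 / lin_frac M' z"
    using lin_frac_mult[OF assms(2), of "mat2 0 (- 1) 1 0" N M'] fricke_in_R_minus M'
    unfolding R_group_def lin_frac_fricke by simp
qed

lemma heegner_points_fricke:
  assumes "p > 0" "z \<in> heegner_points p D"
  shows "- 1 / z \<in> heegner_points p D"
proof -
  obtain A B C w where Q: "heegner_form p D (A, B, C)" "bqf_root (A, B, C) w" "z = of_real (sqrt p) * w"
    using assms(2) unfolding heegner_points_def by (auto simp del: bqf_root.simps)
  obtain A' where A': "A = int p * A'" using heegner_formD(4)[OF Q(1)] by (elim dvdE)
  show ?thesis
    using heegner_form_fricke[OF assms(1) Q(1,2)[unfolded A']]
    unfolding Q(3) heegner_points_def by blast
qed

lemma heegner_points_R_equiv:
  assumes "p > 0" "z \<in> heegner_points p D" "(z', z) \<in> R_equiv p"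
  shows "z' \<in> heegner_points p D"
proof -
  have plus: "z' \<in> heegner_points p D"
    if *: "z \<in> heegner_points p D" "M \<in> R_plus p" "z = lin_frac M z'" "Im z' > 0" for M z
  proof -
    obtain w' where w': "z' = of_real (sqrt p) * w'" "Im w' > 0"
      using scaled_upper_half_plane[OF *(4) assms(1)] .
    obtain Q w where Q: "heegner_form p D Q" "bqf_root Q w" "z = of_real (sqrt p) * w"
      using *(1) unfolding heegner_points_def by blast
    have "of_real (sqrt p) * w = lin_frac M (of_real (sqrt p) * w')"
      using *(3) unfolding Q(3) w'(1) .
    then show ?thesis
      using heegner_form_R_plus[OF assms(1) Q(1,2) w'(2) *(2)]
      unfolding heegner_points_def w'(1) by blast
  qed
  obtain M where M: "M \<in> R_group p" "z = lin_frac M z'" "Im z' > 0"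
    using assms(3) unfolding R_equiv_def upper_half_plane_def by auto
  show ?thesis
  proof (cases "M \<in> R_plus p")
    case True
    then show ?thesis using plus assms(2) M by blast
  next
    case False
    then have "M \<in> R_minus p" using M(1) unfolding R_group_def by blast
    then obtain M' where M': "M' \<in> R_plus p" "z = - 1 / lin_frac M' z'"
      using R_minus_factor M(2,3) by metis
    have "lin_frac M' z' = - 1 / z" unfolding M'(2) by simp
    then show ?thesis
      using plus[OF heegner_points_fricke[OF assms(1,2)] M'(1) _ M(3)] by simp
  qed
qed

lemma heegner_points_disjoint:
  assumes "z \<in> heegner_points p D" "z \<in> heegner_points p D'" "p > 0"
  shows "\<exists>a b. a \<noteq> 0 \<and> b \<noteq> 0 \<and> D * a\<^sup>2 = D' * b\<^sup>2"
proof -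
  obtain A B C w where Q: "heegner_form p D (A, B, C)" "bqf_root (A, B, C) w" "z = of_real (sqrt p) * w"
    using assms(1) unfolding heegner_points_def by (auto simp del: bqf_root.simps)
  obtain A' B' C' w' where Q': "heegner_form p D' (A', B', C')" "bqf_root (A', B', C') w'" "z = of_real (sqrt p) * w'"
    using assms(2) unfolding heegner_points_def by (auto simp del: bqf_root.simps)
  have "w' = w" using Q(3) Q'(3) assms(3) by simp
  then have "D * A'\<^sup>2 = D' * A\<^sup>2"
    using bqf_root_same_point[of A B C w A' B' C'] Q(2) Q'(2) heegner_formD[OF Q(1)] heegner_formD[OF Q'(1)]
    by simp
  then show ?thesis using heegner_formD(1)[OF Q(1)] heegner_formD(1)[OF Q'(1)] by (metis less_irrefl)
qed

section \<open>Elliptic points as Heegner points\<close>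

text \<open>Clearing the denominator in the fixed point equation leaves a quadratic whose leading
  coefficient contains p; this is how Heegner forms arise.\<close>

lemma R_plus_fixed_iff:
  fixes a b c d :: int
  assumes "p > 0" "Im w > 0" "a * d - int p * (b * c) = 1"
  shows "lin_frac (mat2 (of_int a) (of_int b * sqrt p) (of_int c * sqrt p) (of_int d)) (of_real (sqrt p) * w)
      = of_real (sqrt p) * w \<longleftrightarrow> bqf_root (int p * c, d - a, - b) w"
proof -
  have "int p * c \<noteq> 0 \<or> d \<noteq> 0" using assms(1,3) by auto
  then have "real_of_int (int p * c) \<noteq> 0 \<or> real_of_int d \<noteq> 0" by (metis of_int_eq_0_iff)
  from linear_nonzero_upper[OF assms(2) this]
  have k: "of_int (int p * c) * w + of_int d \<noteq> 0" by simp
  have "lin_frac (mat2 (of_int a) (of_int b * sqrt p) (of_int c * sqrt p) (of_int d)) (of_real (sqrt p) * w)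
      = of_real (sqrt p) * w \<longleftrightarrow> (of_int a * w + of_int b) / (of_int (int p * c) * w + of_int d) = w"
    using assms(1) unfolding lin_frac_plus_scaled[OF assms(1)] mult_cancel_left by simp
  also have "\<dots> \<longleftrightarrow> of_int a * w + of_int b = w * (of_int (int p * c) * w + of_int d)"
    using k by (simp add: divide_eq_eq)
  also have "\<dots> \<longleftrightarrow> of_int (int p * c) * w\<^sup>2 + of_int (d - a) * w + of_int (- b) = 0"
  proof -
    have "of_int (int p * c) * w\<^sup>2 + of_int (d - a) * w + of_int (- b) =
        w * (of_int (int p * c) * w + of_int d) - (of_int a * w + of_int b)"
      by (simp add: power2_eq_square algebra_simps)
    then show ?thesis by (metis eq_iff_diff_eq_0)
  qed
  finally show ?thesis using assms(2) by simp
qed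

text \<open>The factors \<open>sqrt p\<close> occur in pairs once the denominator is cleared, so
  this equation is integral as well, now with p also in the middle coefficient.\<close>

lemma R_minus_fixed_iff:
  fixes a b c d :: int
  assumes "p > 0" "Im w > 0" "int p * (a * d) - b * c = 1"
  shows "lin_frac (mat2 (of_int a * sqrt p) (of_int b) (of_int c) (of_int d * sqrt p)) (of_real (sqrt p) * w)
      = of_real (sqrt p) * w \<longleftrightarrow> bqf_root (int p * c, int p * (d - a), - b) w"
proof -
  define q where "q = complex_of_real (sqrt p)"
  have q: "q * q = of_nat p"
    unfolding q_def by (metis abs_of_nat of_real_mult of_real_of_nat_eq real_sqrt_mult_self)
  have Im: "Im (q * w) > 0" using assms(1,2) unfolding q_def by simp
  have "c \<noteq> 0 \<or> d \<noteq> 0" using assms(3) by auto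
  then have "real_of_int c \<noteq> 0 \<or> real_of_int d * sqrt p \<noteq> 0" using assms(1) by simp
  from linear_nonzero_upper[OF Im this]
  have k: "of_int c * (q * w) + of_int d * q \<noteq> 0" unfolding q_def by simp
  have "lin_frac (mat2 (of_int a * sqrt p) (of_int b) (of_int c) (of_int d * sqrt p)) (q * w) = q * w
      \<longleftrightarrow> of_int a * q * (q * w) + of_int b = (q * w) * (of_int c * (q * w) + of_int d * q)"
    using k unfolding lin_frac_mat2 q_def by (simp add: divide_eq_eq)
  also have "\<dots> \<longleftrightarrow> of_int (int p * c) * w\<^sup>2 + of_int (int p * (d - a)) * w + of_int (- b) = 0"
  proof -
    have "(q * w) * (of_int c * (q * w) + of_int d * q) - (of_int a * q * (q * w) + of_int b) =
        (q * q) * (of_int c * w\<^sup>2 + of_int (d - a) * w) - of_int b"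
      by (simp add: power2_eq_square algebra_simps)
    also have "\<dots> = of_int (int p * c) * w\<^sup>2 + of_int (int p * (d - a)) * w + of_int (- b)"
      unfolding q by (simp add: algebra_simps)
    finally show ?thesis by (metis eq_iff_diff_eq_0)
  qed
  finally show ?thesis using assms(2) unfolding q_def by simp
qed

text \<open>The discriminant of the fixed point form is the squared trace minus 4. It is negative,
  so the trace is 0, 1 or -1. The form is truly quadratic, since \<open>c = 0\<close> would make M
  plus or minus the identity.\<close>

lemma R_plus_fixed_heegner:
  assumes "p > 0" "Im z > 0" "M \<in> R_plus p" "M \<noteq> mat 1" "M \<noteq> - mat 1" "lin_frac M z = z"
  shows "z \<in> heegner_points p (- 3) \<union> heegner_points p (- 4)"
proof -
  obtain w where w: "z = of_real (sqrt p) * w" "Im w > 0"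
    using scaled_upper_half_plane[OF assms(2,1)] .
  obtain a b c d where 1: "a * d - int p * (b * c) = 1"
    "M = mat2 (of_int a) (of_int b * sqrt p) (of_int c * sqrt p) (of_int d)"
    using assms(3) unfolding R_plus_iff by blast
  have root: "bqf_root (int p * c, d - a, - b) w"
    using assms(6) unfolding 1(2) w(1) R_plus_fixed_iff[OF assms(1) w(2) 1(1)] .
  have c: "int p * c \<noteq> 0"
  proof
    assume c: "int p * c = 0"
    have eq: "of_int (d - a) * w = of_int b"
      using root unfolding c by simp
    have "Im (of_int (d - a) * w) = (d - a) * Im w" by simp
    then have "(d - a) * Im w = 0" unfolding eq by simp
    then have da: "d = a" using w(2) by simp
    then have b: "b = 0" using eq by simp
    have "a * a = 1" using 1(1) da b by simp
    then have "a = 1 \<or> a = - 1" by (simp add: zmult_eq_1_iff)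
    then show False
      using assms(1,4,5) c unfolding 1(2) mat_1_eq_mat2 uminus_mat2 mat2_eq_iff
      by (auto simp: da b)
  qed
  have disc: "(d - a)\<^sup>2 - 4 * (int p * c) * (- b) = (a + d)\<^sup>2 - 4 * (a * d - int p * (b * c))"
    by (simp add: power2_eq_square algebra_simps)
  then have "(a + d)\<^sup>2 < 4" using bqf_root_disc_neg[OF root c] unfolding 1(1) by simp
  then have "\<bar>a + d\<bar> < 2" using power2_less_imp_less[of "\<bar>a + d\<bar>" 2] by simp
  then have "a + d = 0 \<or> a + d = 1 \<or> a + d = - 1" by linarith
  then have "(d - a)\<^sup>2 - 4 * (int p * c) * (- b) = - 4 \<or> (d - a)\<^sup>2 - 4 * (int p * c) * (- b) = - 3"
    unfolding disc 1(1) by auto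
  then show ?thesis
    using heegner_pointsI[OF root c] unfolding w(1) by (metis UnI1 UnI2 dvd_triv_left)
qed

text \<open>With \<open>T = a + d\<close> the discriminant is \<open>p * (p * T^2 - 4)\<close>; for
  \<open>p \<ge> 5\<close> it is negative only if \<open>T = 0\<close>.\<close>

lemma R_minus_fixed_heegner:
  assumes "p \<ge> 5" "Im z > 0" "M \<in> R_minus p" "lin_frac M z = z"
  shows "z \<in> heegner_points p (- 4 * int p)"
proof -
  have p0: "p > 0" using assms(1) by simp
  obtain w where w: "z = of_real (sqrt p) * w" "Im w > 0"
    using scaled_upper_half_plane[OF assms(2) p0] .
  obtain a b c d where 1: "int p * (a * d) - b * c = 1"
    "M = mat2 (of_int a * sqrt p) (of_int b) (of_int c) (of_int d * sqrt p)"
    using assms(3) unfolding R_minus_iff by blast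
  have root: "bqf_root (int p * c, int p * (d - a), - b) w"
    using assms(4) unfolding 1(2) w(1) R_minus_fixed_iff[OF p0 w(2) 1(1)] .
  have c: "int p * c \<noteq> 0"
  proof
    assume "int p * c = 0"
    then have "int p * (a * d) = 1" using 1(1) p0 by simp
    then show False using assms(1) by (simp add: zmult_eq_1_iff)
  qed
  have disc: "(int p * (d - a))\<^sup>2 - 4 * (int p * c) * (- b)
      = int p * (int p * (a + d)\<^sup>2 - 4 * (int p * (a * d) - b * c))"
    by (simp add: power2_eq_square algebra_simps)
  then have "int p * (int p * (a + d)\<^sup>2 - 4) < 0"
    using bqf_root_disc_neg[OF root c] unfolding 1(1) by simp
  then have "int p * (a + d)\<^sup>2 < 4" using p0 by (simp add: mult_less_0_iff)
  moreover have "int p * 1 \<le> int p * (a + d)\<^sup>2" if "a + d \<noteq> 0"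
  proof -
    have "(a + d)\<^sup>2 > 0" using that by simp
    then have "1 \<le> (a + d)\<^sup>2" by linarith
    then show ?thesis by (intro mult_left_mono) auto
  qed
  ultimately have "a + d = 0" using assms(1) by fastforce
  then have "(int p * (d - a))\<^sup>2 - 4 * (int p * c) * (- b) = - 4 * int p"
    unfolding disc 1(1) by simp
  then show ?thesis using heegner_pointsI[OF root c] unfolding w(1) by simp
qed

lemma heegner_points_cases:
  assumes "z \<in> heegner_points p D"
  obtains A B C w where "heegner_form p D (int p * A, B, C)" "bqf_root (int p * A, B, C) w"
    "z = of_real (sqrt p) * w"
proof -
  obtain A B C w where Q: "heegner_form p D (A, B, C)" "bqf_root (A, B, C) w" "z = of_real (sqrt p) * w"
    using assms unfolding heegner_points_def by (auto simp del: bqf_root.simps)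
  obtain A' where "A = int p * A'" using heegner_formD(4)[OF Q(1)] by (elim dvdE)
  then show ?thesis using that Q by blast
qed

text \<open>Solves the fixed point equation for the matrix: the form prescribes
  \<open>c = A\<close>, \<open>b = - C\<close> and \<open>d - a = B\<close>, and the discriminant
  prescribes the trace T up to sign.\<close>

lemma heegner_fixed_R_plus:
  assumes "p > 0" "D = - 3 \<or> D = - 4" "z \<in> heegner_points p D"
  shows "\<exists>M\<in>R_plus p. M \<noteq> mat 1 \<and> M \<noteq> - mat 1 \<and> lin_frac M z = z"
proof -
  obtain A B C w where Q: "heegner_form p D (int p * A, B, C)" "bqf_root (int p * A, B, C) w"
    "z = of_real (sqrt p) * w"
    using heegner_points_cases[OF assms(3)] .
  note h = heegner_formD[OF Q(1)]
  obtain T where T: "D = T\<^sup>2 - 4"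
  proof -
    have "- 4 = (0::int)\<^sup>2 - 4" "- 3 = (1::int)\<^sup>2 - 4" by simp_all
    then show ?thesis using assms(2) that by metis
  qed
  \<comment> \<open>B and T have the parity of D, so \<open>a = (T - B) / 2\<close> is an
    integer.\<close>
  have "even (T - B)"
  proof -
    have "T\<^sup>2 - B\<^sup>2 = 2 * (2 * (1 - int p * A * C))" using h(3) T by (simp add: algebra_simps)
    then have "even (T\<^sup>2 - B\<^sup>2)" by simp
    then show ?thesis by simp
  qed
  then obtain a where a: "T - B = 2 * a" by (elim evenE)
  define d where "d = T - a"
  have B: "d - a = B" "T = a + d" using a unfolding d_def by simp_all
  have "4 * (a * d - int p * (- C * A)) = (a + d)\<^sup>2 - (d - a)\<^sup>2 + 4 * (int p * A) * C"
    by (simp add: power2_eq_square algebra_simps)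
  also have "\<dots> = 4" using h(3) unfolding B T by simp
  finally have det: "a * d - int p * (- C * A) = 1" by simp
  define M where "M = mat2 (of_int a) (of_int (- C) * sqrt p) (of_int A * sqrt p) (of_int d)"
  have "lin_frac M z = z"
    using Q(2) unfolding M_def Q(3) R_plus_fixed_iff[OF assms(1) bqf_root_Im_pos[OF Q(2)] det] B(1) by simp
  moreover have "M \<in> R_plus p" unfolding R_plus_iff M_def using det by blast
  moreover have "A \<noteq> 0" using h(1) by auto
  then have "M \<noteq> mat 1" "M \<noteq> - mat 1"
    using assms(1) unfolding M_def mat_1_eq_mat2 uminus_mat2 mat2_eq_iff by simp_all
  ultimately show ?thesis by blast
qed

text \<open>Since \<open>B^2 = 4 * (A * C - p)\<close> and p divides A. Hence for this discriminant
  all middle coefficients agree modulo p.\<close>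

lemma heegner_form_middle_divisible:
  assumes "prime p" "p \<noteq> 2" "heegner_form p (- 4 * int p) (A, B, C)"
  shows "2 * int p dvd B"
proof -
  note h = heegner_formD[OF assms(3)]
  have eq: "B\<^sup>2 = 4 * (A * C - int p)" using h(3) by (simp add: algebra_simps)
  then have "even (B\<^sup>2)" by simp
  then have "even B" by simp
  moreover have "int p dvd B\<^sup>2" unfolding eq using h(4) by simp
  then have "int p dvd B" using assms(1) prime_dvd_power[of "int p" B 2] by simp
  moreover have "coprime 2 (int p)"
    using assms(1,2) primes_coprime[of 2 p] by (metis coprime_int_iff of_nat_numeral two_is_prime_nat)
  ultimately show ?thesis by (metis divides_mult)
qed

text \<open>Writing \<open>B = 2 * p * d\<close>, the trace-zero matrix with off-diagonal entries
  \<open>- C\<close> and A fixes the point; discriminant \<open>- 4 * p\<close> says precisely that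
  its determinant is 1.\<close>

lemma heegner_fixed_R_minus:
  assumes "prime p" "p \<noteq> 2" "z \<in> heegner_points p (- 4 * int p)"
  shows "\<exists>M\<in>R_minus p. M \<noteq> mat 1 \<and> M \<noteq> - mat 1 \<and> lin_frac M z = z"
proof -
  have p0: "p > 0" using assms(1) prime_gt_0_nat by blast
  obtain A B C w where Q: "heegner_form p (- 4 * int p) (int p * A, B, C)"
    "bqf_root (int p * A, B, C) w" "z = of_real (sqrt p) * w"
    using heegner_points_cases[OF assms(3)] .
  obtain d where d: "B = 2 * int p * d"
    using heegner_form_middle_divisible[OF assms(1,2) Q(1)] by (elim dvdE)
  have "4 * int p * (int p * (- d * d) - - C * A) = 4 * int p * 1"
    using heegner_formD(3)[OF Q(1)] unfolding d by (simp add: power2_eq_square algebra_simps)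
  then have det: "int p * (- d * d) - - C * A = 1" using p0 by simp
  define M where "M = mat2 (of_int (- d) * sqrt p) (of_int (- C)) (of_int A) (of_int d * sqrt p)"
  have "lin_frac M z = z"
    using Q(2) unfolding M_def Q(3) R_minus_fixed_iff[OF p0 bqf_root_Im_pos[OF Q(2)] det] d
    by (simp add: algebra_simps)
  moreover have "M \<in> R_minus p" unfolding R_minus_iff M_def using det by blast
  \<comment> \<open>The diagonal entries are opposite; if equal they are 0, so M is not plus or
    minus the identity.\<close>
  moreover have "- real_of_int d * sqrt p = d * sqrt p \<Longrightarrow> real_of_int d * sqrt p = 0" by simp
  then have "M \<noteq> mat 1" "M \<noteq> - mat 1"
    unfolding M_def mat_1_eq_mat2 uminus_mat2 mat2_eq_iff by auto
  ultimately show ?thesis by blast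
qed

lemma stabilizer_elliptic_iff:
  assumes "Im z > 0"
  shows "M \<in> R_stabilizer N z \<inter> elliptic_elements N \<longleftrightarrow>
    M \<in> R_group N \<and> M \<noteq> mat 1 \<and> M \<noteq> - mat 1 \<and> lin_frac M z = z"
  using assms unfolding R_stabilizer_def elliptic_elements_def upper_half_plane_def by blast

lemma elliptic_points_eq_heegner:
  assumes "prime p" "p \<ge> 5"
  shows "elliptic_points p =
    heegner_points p (- 3) \<union> heegner_points p (- 4) \<union> heegner_points p (- 4 * int p)"
proof -
  have p: "p > 0" "p \<noteq> 2" using assms by auto
  have "z \<in> elliptic_points p \<longleftrightarrow>
      Im z > 0 \<and> (\<exists>M\<in>R_plus p \<union> R_minus p. M \<noteq> mat 1 \<and> M \<noteq> - mat 1 \<and> lin_frac M z = z)" for z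
    using stabilizer_elliptic_iff[of z _ p] unfolding elliptic_points_def upper_half_plane_def R_group_def
    by blast
  then have iff: "z \<in> elliptic_points p \<longleftrightarrow> Im z > 0 \<and>
      ((\<exists>M\<in>R_plus p. M \<noteq> mat 1 \<and> M \<noteq> - mat 1 \<and> lin_frac M z = z) \<or>
       (\<exists>M\<in>R_minus p. M \<noteq> mat 1 \<and> M \<noteq> - mat 1 \<and> lin_frac M z = z))" for z
    unfolding bex_Un .
  show ?thesis
  proof (intro subset_antisym subsetI)
    fix z assume "z \<in> elliptic_points p"
    then show "z \<in> heegner_points p (- 3) \<union> heegner_points p (- 4) \<union> heegner_points p (- 4 * int p)"
      unfolding iff using R_plus_fixed_heegner[OF p(1)] R_minus_fixed_heegner[OF assms(2)] by blast
  next
    fix z assume z: "z \<in> heegner_points p (- 3) \<union> heegner_points p (- 4) \<union> heegner_points p (- 4 * int p)"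
    then have "Im z > 0" using heegner_points_upper[OF _ p(1)] by blast
    then show "z \<in> elliptic_points p"
      unfolding iff using z heegner_fixed_R_plus[OF p(1)] heegner_fixed_R_minus[OF assms(1) p(2)]
      by blast
  qed
qed

lemma minus_elliptic_points_eq_heegner:
  assumes "prime p" "p \<ge> 5"
  shows "{z \<in> upper_half_plane. \<exists>M \<in> elliptic_elements p \<inter> R_minus p. M \<in> R_stabilizer p z} =
    heegner_points p (- 4 * int p)" (is "?L = _")
proof -
  have p: "p > 0" "p \<noteq> 2" using assms by auto
  have iff: "z \<in> ?L \<longleftrightarrow>
      Im z > 0 \<and> (\<exists>M\<in>R_minus p. M \<noteq> mat 1 \<and> M \<noteq> - mat 1 \<and> lin_frac M z = z)" for z
    using stabilizer_elliptic_iff[of z _ p] unfolding upper_half_plane_def R_group_def by blast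
  show ?thesis
  proof (intro subset_antisym subsetI)
    show "z \<in> heegner_points p (- 4 * int p)" if "z \<in> ?L" for z
      using that R_minus_fixed_heegner[OF assms(2)] unfolding iff by blast
    show "z \<in> ?L" if z: "z \<in> heegner_points p (- 4 * int p)" for z
      using heegner_fixed_R_minus[OF assms(1) p(2) z] heegner_points_upper[OF z p(1)] unfolding iff by blast
  qed
qed

section \<open>Separation of the three families of Heegner points\<close>

text \<open>The multiplicity of q is odd on the left and even on the right.\<close>

lemma prime_times_square_neq:
  fixes q m n a b :: int
  assumes "prime q" "\<not> q dvd m" "\<not> q dvd n" "a \<noteq> 0" "b \<noteq> 0"
  shows "q * m * a\<^sup>2 \<noteq> n * b\<^sup>2"
proof
  assume eq: "q * m * a\<^sup>2 = n * b\<^sup>2"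
  have pe: "prime_elem q" using assms(1) by (rule prime_imp_prime_elem)
  have nz: "q \<noteq> 0" "m \<noteq> 0" "n \<noteq> 0" using assms by auto
  have "multiplicity q (q * m * a\<^sup>2) = 1 + 2 * multiplicity q a"
    using pe nz assms by (simp add: prime_elem_multiplicity_mult_distrib prime_elem_multiplicity_power_distrib
        not_dvd_imp_multiplicity_0)
  moreover have "multiplicity q (n * b\<^sup>2) = 2 * multiplicity q b"
    using pe nz assms by (simp add: prime_elem_multiplicity_mult_distrib prime_elem_multiplicity_power_distrib
        not_dvd_imp_multiplicity_0)
  ultimately show False unfolding eq by presburger
qed

lemma heegner_points_pairwise_disjoint:
  assumes "prime p" "p \<ge> 5"
  shows "heegner_points p (- 3) \<inter> heegner_points p (- 4) = {}"
    and "heegner_points p (- 3) \<inter> heegner_points p (- 4 * int p) = {}"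
    and "heegner_points p (- 4) \<inter> heegner_points p (- 4 * int p) = {}"
proof -
  have p0: "p > 0" using assms by simp
  have pp: "prime (int p)" using assms(1) by simp
  have nd: "\<not> int p dvd 1" "\<not> int p dvd 3" "\<not> int p dvd 4"
    using assms(2) zdvd_not_zless[of 1 "int p"] zdvd_not_zless[of 3 "int p"] zdvd_not_zless[of 4 "int p"]
    by simp_all
  have disj: "heegner_points p D \<inter> heegner_points p D' = {}"
    if "\<And>a b. a \<noteq> 0 \<Longrightarrow> b \<noteq> 0 \<Longrightarrow> D * a\<^sup>2 \<noteq> D' * b\<^sup>2" for D D'
    using heegner_points_disjoint[OF _ _ p0] that by blast
  show "heegner_points p (- 3) \<inter> heegner_points p (- 4) = {}"
    \<comment> \<open>Here the separating prime is 3; in the two cases below it is p.\<close>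
    by (rule disj) (use prime_times_square_neq[of 3 1 4] in simp)
  show "heegner_points p (- 3) \<inter> heegner_points p (- 4 * int p) = {}"
  proof (rule disj)
    fix a b :: int assume "a \<noteq> 0" "b \<noteq> 0"
    then show "- 3 * a\<^sup>2 \<noteq> - 4 * int p * b\<^sup>2"
      using prime_times_square_neq[OF pp nd(3,2), of b a] by (simp add: mult.commute)
  qed
  show "heegner_points p (- 4) \<inter> heegner_points p (- 4 * int p) = {}"
  proof (rule disj)
    fix a b :: int assume "a \<noteq> 0" "b \<noteq> 0"
    then show "- 4 * a\<^sup>2 \<noteq> - 4 * int p * b\<^sup>2"
      using prime_times_square_neq[OF pp nd(1,1), of b a] by simp
  qed
qed

text \<open>Each family is stable under the group, so a common class would put a point of the first
  family into the second.\<close>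

lemma heegner_classes_disjoint:
  assumes "p > 0" "heegner_points p D \<inter> heegner_points p D' = {}"
  shows "heegner_points p D // R_equiv p \<inter> heegner_points p D' // R_equiv p = {}"
proof (rule ccontr)
  assume "heegner_points p D // R_equiv p \<inter> heegner_points p D' // R_equiv p \<noteq> {}"
  then obtain z w where zw: "z \<in> heegner_points p D" "w \<in> heegner_points p D'"
    "R_equiv p `` {z} = R_equiv p `` {w}"
    unfolding quotient_def by auto
  then have "(z, w) \<in> R_equiv p"
    using eq_equiv_class_iff[OF equiv_R_equiv] heegner_points_upper[OF _ assms(1)]
    unfolding upper_half_plane_def by blast
  then show False using heegner_points_R_equiv[OF assms(1) zw(2)] zw(1) assms(2) by blast
qed

lemma quotient_Un: "(A \<union> B) // r = A // r \<union> B // r"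
  unfolding quotient_def by blast

lemma Ell_minus_eq_heegner:
  assumes "prime p" "p \<ge> 5"
  shows "Ell_minus p = heegner_points p (- 4 * int p) // R_equiv p"
  unfolding Ell_minus_def minus_elliptic_points_eq_heegner[OF assms] ..

lemma Ell_plus_eq_heegner:
  assumes "prime p" "p \<ge> 5"
  shows "Ell_plus p = heegner_points p (- 3) // R_equiv p \<union> heegner_points p (- 4) // R_equiv p"
proof -
  have "p > 0" using assms(2) by simp
  note * = heegner_classes_disjoint[OF this]
  show ?thesis
    using *[OF heegner_points_pairwise_disjoint(2)[OF assms]] *[OF heegner_points_pairwise_disjoint(3)[OF assms]]
    unfolding Ell_plus_def Ell_def Ell_minus_eq_heegner[OF assms] elliptic_points_eq_heegner[OF assms] quotient_Un
    by blast
qed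

lemma fricke_R_equiv:
  assumes "Im z > 0"
  shows "(z, - 1 / z) \<in> R_equiv N"
proof -
  have "(Re z)\<^sup>2 + (Im z)\<^sup>2 > 0" using assms by (simp add: add_nonneg_pos)
  then have "Im (- 1 / z) > 0" using assms by (simp add: Im_divide)
  moreover have "- 1 / z = lin_frac (mat2 0 (- 1) 1 0) z" by (simp add: lin_frac_fricke)
  ultimately show ?thesis
    using assms fricke_in_R_minus unfolding R_equiv_def upper_half_plane_def R_group_def by blast
qed

section \<open>Counting the classes\<close>

lemma heegner_points_single_class:
  assumes "prime p" "p \<ge> 5" "D = - 3 \<or> D = - 4"
    and "z \<in> heegner_points p D" "z' \<in> heegner_points p D"
  shows "(z', z) \<in> R_equiv p"
proof -
  have p: "p > 0" "p \<noteq> 2" using assms by auto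
  have "(int p)\<^sup>2 > 4" using assms(2) power_mono[of 5 "int p" 2] by simp
  then have sq: "\<not> (int p)\<^sup>2 dvd D"
    using assms(3) zdvd_not_zless[of "- D" "(int p)\<^sup>2"] by auto
  obtain A B C w where Q: "heegner_form p D (int p * A, B, C)" "bqf_root (int p * A, B, C) w"
    "z = of_real (sqrt p) * w"
    using heegner_points_cases[OF assms(4)] .
  obtain A' B' C' w' where Q': "heegner_form p D (int p * A', B', C')" "bqf_root (int p * A', B', C') w'"
    "z' = of_real (sqrt p) * w'"
    using heegner_points_cases[OF assms(5)] .
  have equiv: "bqf_equiv P P'" if "heegner_form p D P" "heegner_form p D P'" for P P'
    using class_number_one[OF assms(3)] that unfolding heegner_form_def by blast
  \<comment> \<open>Both \<open>B^2\<close> and \<open>B'^2\<close> are congruent to D modulo p, so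
    B and \<open>B'\<close> agree modulo p up to sign.\<close>
  have "(B - B') * (B + B') = int p * (4 * A * C - 4 * A' * C')"
    using heegner_formD(3)[OF Q(1)] heegner_formD(3)[OF Q'(1)] by (simp add: power2_eq_square algebra_simps)
  then have "int p dvd (B - B') * (B + B')" by simp
  then consider "int p dvd B - B'" | "int p dvd B - - B'"
    using assms(1) by (auto simp: prime_dvd_mult_iff)
  then show ?thesis
  proof cases
    case 1
    then show ?thesis
      using heegner_forms_R_equiv[OF assms(1) p(2) sq Q(1,2) Q'(1,2) equiv[OF Q(1) Q'(1)]]
      unfolding Q(3) Q'(3) by blast
  next
    case 2
    \<comment> \<open>Applying the involution to \<open>z'\<close> replaces \<open>B'\<close> by
      \<open>- B'\<close> and reduces to the first case.\<close>
    note F = heegner_form_fricke[OF p(1) Q'(1,2)]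
    have "(- 1 / z', z) \<in> R_equiv p"
      using heegner_forms_R_equiv[OF assms(1) p(2) sq Q(1,2) F(1,2) equiv[OF Q(1) F(1)] 2]
      unfolding Q(3) Q'(3) F(3) .
    moreover have "(z', - 1 / z') \<in> R_equiv p"
      using fricke_R_equiv heegner_points_upper[OF assms(5) p(1)] .
    ultimately show ?thesis using equiv_R_equiv[of p] unfolding equiv_def trans_def by blast
  qed
qed

lemma heegner_classes_card:
  assumes "prime p" "p \<ge> 5" "D = - 3 \<or> D = - 4"
  shows "finite (heegner_points p D // R_equiv p)"
    and "card (heegner_points p D // R_equiv p) = (if heegner_points p D = {} then 0 else 1)"
proof -
  have "heegner_points p D // R_equiv p = {R_equiv p `` {z}}" if z: "z \<in> heegner_points p D" for z
  proof -
    have "R_equiv p `` {z'} = R_equiv p `` {z}" if "z' \<in> heegner_points p D" for z'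
      using heegner_points_single_class[OF assms z that] equiv_class_eq[OF equiv_R_equiv] by blast
    then show ?thesis using z unfolding quotient_def by blast
  qed
  then have "heegner_points p D = {} \<or> (\<exists>X. heegner_points p D // R_equiv p = {X})" by blast
  then show "finite (heegner_points p D // R_equiv p)"
    and "card (heegner_points p D // R_equiv p) = (if heegner_points p D = {} then 0 else 1)"
    by (auto simp del: quotient_is_empty)
qed

lemma heegner_points_nonemptyI:
  assumes "p > 0" "B\<^sup>2 - 4 * int p * C = D" "D < 0"
  shows "heegner_points p D \<noteq> {}"
proof -
  have "heegner_form p D (int p, B, C)"
    using assms unfolding heegner_form_def pos_def_form_iff by simp
  then show ?thesis
    using bqf_root_exists unfolding heegner_form_def heegner_points_def by blast
qed

text \<open>The middle coefficient must be even, say \<open>2 * x\<close>, and then p divides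
  \<open>x^2 + 1\<close>; conversely the form \<open>(p, 2 * x, C)\<close> serves.\<close>

lemma heegner_points_minus_4_nonempty_iff:
  assumes "prime p" "p \<ge> 5"
  shows "heegner_points p (- 4) \<noteq> {} \<longleftrightarrow> [p = 1] (mod 4)"
proof -
  have "heegner_points p (- 4) \<noteq> {} \<longleftrightarrow> (\<exists>x. int p dvd x\<^sup>2 + 1)"
  proof
    assume "heegner_points p (- 4) \<noteq> {}"
    then obtain z where "z \<in> heegner_points p (- 4)" by blast
    then obtain A B C w where Q: "heegner_form p (- 4) (int p * A, B, C)"
      by (rule heegner_points_cases)
    have eq: "B\<^sup>2 = 4 * (int p * A * C - 1)" using heegner_formD(3)[OF Q] by simp
    then have "even (B\<^sup>2)" by simp
    then obtain x where "B = 2 * x" by (auto elim: evenE)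
    then have "x\<^sup>2 + 1 = int p * (A * C)" using eq by simp
    then show "\<exists>x. int p dvd x\<^sup>2 + 1" by (metis dvd_triv_left)
  next
    assume "\<exists>x. int p dvd x\<^sup>2 + 1"
    then obtain x C where "x\<^sup>2 + 1 = int p * C" by (auto elim: dvdE)
    then have "(2 * x)\<^sup>2 - 4 * int p * C = - 4" by simp
    then show "heegner_points p (- 4) \<noteq> {}"
      using heegner_points_nonemptyI assms by (metis neg_less_0_iff_less prime_gt_0_nat zero_less_numeral)
  qed
  then show ?thesis using square_eq_minus_one_mod_prime[OF assms] by simp
qed

lemma heegner_points_minus_3_nonempty_iff:
  assumes "prime p" "p \<ge> 5"
  shows "heegner_points p (- 3) \<noteq> {} \<longleftrightarrow> [p = 1] (mod 3)"
proof -
  have odd: "odd p" using assms prime_odd_nat[of p] by auto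
  have "heegner_points p (- 3) \<noteq> {} \<longleftrightarrow> (\<exists>x. int p dvd x\<^sup>2 + 3)"
  proof
    assume "heegner_points p (- 3) \<noteq> {}"
    then obtain z where "z \<in> heegner_points p (- 3)" by blast
    then obtain A B C w where Q: "heegner_form p (- 3) (int p * A, B, C)"
      by (rule heegner_points_cases)
    have "B\<^sup>2 + 3 = int p * (4 * A * C)" using heegner_formD(3)[OF Q] by simp
    then show "\<exists>x. int p dvd x\<^sup>2 + 3" by (metis dvd_triv_left)
  next
    assume "\<exists>x. int p dvd x\<^sup>2 + 3"
    then obtain x where x: "int p dvd x\<^sup>2 + 3" by blast
    \<comment> \<open>Discriminant -3 needs an odd middle coefficient; adding the odd p repairs the
      parity without changing the residue. Then 4 divides \<open>y^2 + 3\<close> as well.\<close>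
    define y where "y = (if odd x then x else x + int p)"
    have "int p dvd y\<^sup>2 + 3"
    proof (cases "odd x")
      case False
      have "y\<^sup>2 + 3 = (x\<^sup>2 + 3) + int p * (2 * x + int p)"
        using False unfolding y_def by (simp add: power2_eq_square algebra_simps)
      then show ?thesis using x by (metis dvd_add dvd_triv_left)
    qed (use x y_def in simp)
    moreover have "odd y" using odd unfolding y_def by simp
    then obtain k where "y = 2 * k + 1" by (elim oddE)
    then have "y\<^sup>2 + 3 = 4 * (k\<^sup>2 + k + 1)" by (simp add: power2_eq_square algebra_simps)
    then have "4 dvd y\<^sup>2 + 3" by simp
    moreover have "coprime 4 (int p)"
      using odd coprime_power_left_iff[of 2 2 "int p"] by simp
    ultimately have "4 * int p dvd y\<^sup>2 + 3" by (metis divides_mult)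
    then obtain C where "y\<^sup>2 + 3 = 4 * int p * C" by (elim dvdE)
    then have "y\<^sup>2 - 4 * int p * C = - 3" by simp
    then show "heegner_points p (- 3) \<noteq> {}"
      using heegner_points_nonemptyI assms by (metis neg_less_0_iff_less prime_gt_0_nat zero_less_numeral)
  qed
  then show ?thesis using square_eq_minus_three_mod_prime[OF assms] by simp
qed

lemma card_Ell_plus:
  assumes "prime p" "p \<ge> 5"
  shows "finite (Ell_plus p)"
    and "card (Ell_plus p) = (if [p = 1] (mod 3) then 1 else 0) + (if [p = 1] (mod 4) then 1 else 0)"
proof -
  have "p > 0" using assms by simp
  note disj = heegner_classes_disjoint[OF this heegner_points_pairwise_disjoint(1)[OF assms]]
  note c = heegner_classes_card[OF assms]
  show "finite (Ell_plus p)"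
    unfolding Ell_plus_eq_heegner[OF assms] using c(1) by simp
  have "card (Ell_plus p) = card (heegner_points p (- 3) // R_equiv p) + card (heegner_points p (- 4) // R_equiv p)"
    unfolding Ell_plus_eq_heegner[OF assms] using c(1) disj by (intro card_Un_disjoint) simp_all
  then show "card (Ell_plus p) = (if [p = 1] (mod 3) then 1 else 0) + (if [p = 1] (mod 4) then 1 else 0)"
    using c(2)[of "- 3"] c(2)[of "- 4"] heegner_points_minus_3_nonempty_iff[OF assms]
      heegner_points_minus_4_nonempty_iff[OF assms] by presburger
qed

section \<open>Classes of discriminant -4p and reduced forms\<close>

text \<open>As p divides the discriminant, the form has a double root modulo p. Shifting by that
  root makes the last coefficient divisible by p, and a swap moves it to the front.\<close>

lemma equivalent_heegner_form_exists:
  assumes "prime p" "p \<noteq> 2" "pos_def_form Q" "form_discriminant Q = - 4 * int p"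
  shows "\<exists>Q'. bqf_equiv Q Q' \<and> heegner_form p (- 4 * int p) Q'"
proof -
  obtain A B C where Q: "Q = (A, B, C)" by (cases Q)
  have disc: "B\<^sup>2 - 4 * A * C = - 4 * int p" using assms(4) unfolding Q by simp
  then have "B\<^sup>2 = 2 * (2 * (A * C - int p))" by simp
  then have "even (B\<^sup>2)" by simp
  then obtain b where b: "B = 2 * b" by (auto elim: evenE)
  have ACb: "A * C = b\<^sup>2 + int p" using disc unfolding b by simp
  show ?thesis
  proof (cases "int p dvd A")
    case True
    then show ?thesis
      using assms(3,4) bqf_equiv_refl unfolding heegner_form_def Q by (metis fst_conv)
  next
    case False
    then have "coprime A (int p)"
      using assms(1) by (metis coprime_commute prime_imp_coprime prime_nat_int_transfer)
    then obtain v where "[A * v = 1] (mod int p)" using cong_solve_coprime_int by blast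
    then have "int p dvd A * v - 1" by (simp add: cong_iff_dvd_diff)
    then have "int p dvd - b * (A * v - 1)" by simp
    \<comment> \<open>The double root: t solves \<open>A * t + b = 0\<close> modulo p, where v
      inverts A.\<close>
    define t where "t = - b * v"
    have "A * t + b = - b * (A * v - 1)" unfolding t_def by (simp add: algebra_simps)
    then have t: "int p dvd A * t + b" using \<open>int p dvd - b * (A * v - 1)\<close> by simp
    define C' where "C' = A * t\<^sup>2 + B * t + C"
    have "A * C' = (A * t + b) * (A * t + b) + (A * C - b\<^sup>2)"
      unfolding C'_def b by (simp add: power2_eq_square algebra_simps)
    also have "int p dvd \<dots>" unfolding ACb using t by simp
    finally have C': "int p dvd C'" using False assms(1) by (simp add: prime_dvd_mult_iff)
    have eq: "bqf_equiv Q (C', - (B + 2 * A * t), A)"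
      unfolding Q C'_def by (rule bqf_equiv_trans[OF bqf_equiv_shift bqf_equiv_swap])
    have "heegner_form p (- 4 * int p) (C', - (B + 2 * A * t), A)"
      using pos_def_form_equiv[OF eq assms(3)] bqf_equiv_disc[OF eq] assms(4) C'
      unfolding heegner_form_def fst_conv by simp
    then show ?thesis using eq by blast
  qed
qed

text \<open>A connecting matrix in \<open>R_minus p\<close> can be multiplied by a stabilizing
  element S of \<open>R_minus p\<close>, which gives one in \<open>R_plus p\<close> with the same
  effect. Pulling Q back then yields the unique form of this discriminant at
  \<open>w'\<close>.\<close>

lemma heegner_R_equiv_imp_bqf_equiv:
  assumes "prime p" "p \<noteq> 2"
    and "heegner_form p (- 4 * int p) Q" "bqf_root Q w"
    and "heegner_form p (- 4 * int p) Q'" "bqf_root Q' w'"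
    and "(of_real (sqrt p) * w', of_real (sqrt p) * w) \<in> R_equiv p"
  shows "bqf_equiv Q Q'"
proof -
  have p0: "p > 0" using assms(1) prime_gt_0_nat by blast
  obtain M where M: "M \<in> R_group p" "of_real (sqrt p) * w = lin_frac M (of_real (sqrt p) * w')"
    "Im (of_real (sqrt p) * w') > 0"
    using assms(7) unfolding R_equiv_def upper_half_plane_def by blast
  have "\<exists>M'\<in>R_plus p. of_real (sqrt p) * w = lin_frac M' (of_real (sqrt p) * w')"
  proof (cases "M \<in> R_plus p")
    case False
    then have minus: "M \<in> R_minus p" using M(1) unfolding R_group_def by blast
    have "of_real (sqrt p) * w' \<in> heegner_points p (- 4 * int p)"
      using assms(5,6) unfolding heegner_points_def by blast
    then obtain S where S: "S \<in> R_minus p" "lin_frac S (of_real (sqrt p) * w') = of_real (sqrt p) * w'"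
      using heegner_fixed_R_minus[OF assms(1,2)] by blast
    then have "lin_frac (M ** S) (of_real (sqrt p) * w') = lin_frac M (of_real (sqrt p) * w')"
      using lin_frac_mult[OF M(3,1), of S] unfolding R_group_def by simp
    then show ?thesis using R_minus_mult_minus[OF minus S(1)] M(2) by metis
  qed (use M in blast)
  then obtain M' where M': "M' \<in> R_plus p" "of_real (sqrt p) * w = lin_frac M' (of_real (sqrt p) * w')"
    by blast
  obtain P where P: "heegner_form p (- 4 * int p) P" "bqf_root P w'" "bqf_equiv Q P"
    using heegner_form_R_plus[OF p0 assms(3,4) bqf_root_Im_pos[OF assms(6)] M'] by blast
  have "Q' = P"
    using bqf_root_form_unique[OF P(2) assms(6)] P(1) assms(5) unfolding heegner_form_def by simp
  then show ?thesis using P(3) by simp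
qed

text \<open>Both middle coefficients are divisible by p, and the square of p does not divide
  \<open>4 * p\<close>, so the passage to Gamma_0(p) applies.\<close>

lemma heegner_bqf_equiv_imp_R_equiv:
  assumes "prime p" "p \<noteq> 2"
    and "heegner_form p (- 4 * int p) Q" "bqf_root Q w"
    and "heegner_form p (- 4 * int p) Q'" "bqf_root Q' w'" "bqf_equiv Q Q'"
  shows "(of_real (sqrt p) * w', of_real (sqrt p) * w) \<in> R_equiv p"
proof -
  obtain A B C where Q: "Q = (A, B, C)" by (cases Q)
  obtain A' B' C' where Q': "Q' = (A', B', C')" by (cases Q')
  have "int p dvd B - B'"
    using heegner_form_middle_divisible[OF assms(1,2) assms(3)[unfolded Q]]
      heegner_form_middle_divisible[OF assms(1,2) assms(5)[unfolded Q']]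
    by (meson dvd_diff dvd_mult_right)
  moreover have "\<not> (int p)\<^sup>2 dvd - 4 * int p"
  proof
    assume "(int p)\<^sup>2 dvd - 4 * int p"
    then have "int p * int p dvd 4 * int p" by (simp add: power2_eq_square)
    then have "int p dvd 4" using assms(1) by simp
    then have "p dvd 2 ^ 2" using int_dvd_int_iff[of p 4] by simp
    then show False using assms(1,2) prime_dvd_power primes_dvd_imp_eq two_is_prime_nat by blast
  qed
  ultimately show ?thesis
    using heegner_forms_R_equiv[OF assms(1,2)] assms(3-7) unfolding Q Q' by blast
qed

text \<open>Yields a bijection from a relation that is unique in both directions, so the map on
  classes requires no choice of representatives.\<close>

lemma ex_bij_betw_of_relation:
  assumes "\<And>x. x \<in> A \<Longrightarrow> \<exists>!y. y \<in> B \<and> R x y" "\<And>y. y \<in> B \<Longrightarrow> \<exists>!x. x \<in> A \<and> R x y"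
  shows "\<exists>f. bij_betw f A B"
proof -
  define f where "f x = (THE y. y \<in> B \<and> R x y)" for x
  have f: "f x \<in> B" "R x (f x)" if "x \<in> A" for x
    using theI'[OF assms(1)[OF that]] unfolding f_def by auto
  have "bij_betw f A B"
  proof (rule bij_betwI')
    show "f x = f y \<longleftrightarrow> x = y" if "x \<in> A" "y \<in> A" for x y
      using f[OF that(1)] f[OF that(2)] assms(2) that by metis
    show "f x \<in> B" if "x \<in> A" for x using f that by blast
    show "\<exists>x\<in>A. y = f x" if "y \<in> B" for y
      using assms(2)[OF that] assms(1) f that by metis
  qed
  then show ?thesis by blast
qed

lemma Ell_minus_bij_reduced_forms:
  assumes "prime p" "p \<ge> 5"
  shows "\<exists>f. bij_betw f (Ell_minus p) (reduced_forms_of_disc (- 4 * int p))"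
proof -
  define D where "D = - 4 * int p"
  have p: "p \<noteq> 2" "p > 0" using assms by auto
  \<comment> \<open>A class is related to Q when the Heegner form of one of its points is equivalent
    to Q.\<close>
  define T where "T X Q \<longleftrightarrow> (\<exists>P w. heegner_form p D P \<and> bqf_root P w \<and>
    of_real (sqrt p) * w \<in> X \<and> bqf_equiv P Q)" for X Q
  have E: "Ell_minus p = heegner_points p D // R_equiv p"
    unfolding D_def by (rule Ell_minus_eq_heegner[OF assms])
  note to_R = heegner_bqf_equiv_imp_R_equiv[OF assms(1) p(1), folded D_def]
  note to_bqf = heegner_R_equiv_imp_bqf_equiv[OF assms(1) p(1), folded D_def]
  have sub: "heegner_points p D \<subseteq> upper_half_plane"
    using heegner_points_upper[OF _ p(2)] unfolding upper_half_plane_def by blast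
  have cls: "X \<in> upper_half_plane // R_equiv p" if "X \<in> Ell_minus p" for X
    using that sub unfolding E quotient_def by blast
  \<comment> \<open>Existence is reduction of a representing form; uniqueness holds since points of
    one class have equivalent forms and a form class contains one reduced form.\<close>
  have "\<exists>!Q. Q \<in> reduced_forms_of_disc D \<and> T X Q" if X: "X \<in> Ell_minus p" for X
  proof (rule ex_ex1I)
    obtain z where z: "z \<in> heegner_points p D" "X = R_equiv p `` {z}"
      using X unfolding E by (elim quotientE)
    obtain P w where P: "heegner_form p D P" "bqf_root P w" "z = of_real (sqrt p) * w"
      using z(1) unfolding heegner_points_def by blast
    obtain Q where Q: "bqf_equiv P Q" "reduced_form Q"
      using reduced_form_exists P(1) unfolding heegner_form_def by blast
    have "Q \<in> reduced_forms_of_disc D"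
      using Q P(1) pos_def_form_equiv[OF Q(1)] bqf_equiv_disc[OF Q(1)]
      unfolding reduced_forms_of_disc_def heegner_form_def by simp
    moreover have "z \<in> X" unfolding z(2) using equiv_class_self[OF equiv_R_equiv] sub z(1) by blast
    then have "T X Q" unfolding T_def using P Q(1) by blast
    ultimately show "\<exists>Q. Q \<in> reduced_forms_of_disc D \<and> T X Q" by blast
  next
    fix Q Q' assume *: "Q \<in> reduced_forms_of_disc D \<and> T X Q" "Q' \<in> reduced_forms_of_disc D \<and> T X Q'"
    obtain P w where P: "heegner_form p D P" "bqf_root P w" "of_real (sqrt p) * w \<in> X" "bqf_equiv P Q"
      using * unfolding T_def by blast
    obtain P' w' where P': "heegner_form p D P'" "bqf_root P' w'" "of_real (sqrt p) * w' \<in> X" "bqf_equiv P' Q'"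
      using * unfolding T_def by blast
    have "bqf_equiv P P'"
      using to_bqf[OF P(1,2) P'(1,2)] in_quotient_imp_in_rel[OF equiv_R_equiv cls[OF X]] P(3) P'(3) by simp
    then have "bqf_equiv Q Q'"
      using bqf_equiv_trans[OF bqf_equiv_sym[OF P(4)]] bqf_equiv_trans[OF _ P'(4)] by blast
    then show "Q = Q'"
      using reduced_form_unique * unfolding reduced_forms_of_disc_def by blast
  qed
  \<comment> \<open>Existence moves Q to an equivalent Heegner form and takes its root; uniqueness
    holds since equivalent Heegner forms have roots in one class.\<close>
  moreover have "\<exists>!X. X \<in> Ell_minus p \<and> T X Q" if Q: "Q \<in> reduced_forms_of_disc D" for Q
  proof (rule ex_ex1I)
    obtain P where P: "bqf_equiv Q P" "heegner_form p D P"
      using equivalent_heegner_form_exists[OF assms(1) p(1), of Q] Q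
      unfolding reduced_forms_of_disc_def D_def by blast
    obtain w where w: "bqf_root P w"
      using bqf_root_exists P(2) unfolding heegner_form_def by blast
    define z where "z = of_real (sqrt p) * w"
    have z: "z \<in> heegner_points p D" using P(2) w unfolding z_def heegner_points_def by blast
    then have "R_equiv p `` {z} \<in> Ell_minus p" unfolding E by (rule quotientI)
    moreover have "z \<in> R_equiv p `` {z}" using equiv_class_self[OF equiv_R_equiv] sub z by blast
    then have "T (R_equiv p `` {z}) Q"
      unfolding T_def using P(2) w bqf_equiv_sym[OF P(1)] unfolding z_def by blast
    ultimately show "\<exists>X. X \<in> Ell_minus p \<and> T X Q" by blast
  next
    fix X X' assume *: "X \<in> Ell_minus p \<and> T X Q" "X' \<in> Ell_minus p \<and> T X' Q"
    obtain P w where P: "heegner_form p D P" "bqf_root P w" "of_real (sqrt p) * w \<in> X" "bqf_equiv P Q"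
      using * unfolding T_def by blast
    obtain P' w' where P': "heegner_form p D P'" "bqf_root P' w'" "of_real (sqrt p) * w' \<in> X'" "bqf_equiv P' Q"
      using * unfolding T_def by blast
    have "bqf_equiv P' P" using bqf_equiv_trans[OF P'(4) bqf_equiv_sym[OF P(4)]] .
    then have "(of_real (sqrt p) * w, of_real (sqrt p) * w') \<in> R_equiv p"
      using to_R[OF P'(1,2) P(1,2)] by blast
    then show "X = X'"
      using quotient_eqI[OF equiv_R_equiv cls cls P(3) P'(3)] * by blast
  qed
  ultimately show ?thesis
    using ex_bij_betw_of_relation[of "Ell_minus p" "reduced_forms_of_disc D" T] unfolding D_def by blast
qed

theorem theorem1p1:
  fixes p :: nat
  assumes "prime p" and "p \<ge> 5"
  shows "([p = 1] (mod 12) \<longrightarrow> finite (Ell_plus p) \<and> card (Ell_plus p) = 2) \<and>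
         ([p = 5] (mod 12) \<or> [p = 7] (mod 12) \<longrightarrow>
            finite (Ell_plus p) \<and> card (Ell_plus p) = 1) \<and>
         ([p = 11] (mod 12) \<longrightarrow> finite (Ell_plus p) \<and> card (Ell_plus p) = 0) \<and>
         (\<exists>f. bij_betw f (Ell_minus p) (reduced_forms_of_disc (- 4 * int p)))"
proof -
  \<comment> \<open>The residue modulo 12 determines which of the discriminants -3 (modulo 3) and -4
    (modulo 4) contributes a class.\<close>
  have "p mod 3 = p mod 12 mod 3" "p mod 4 = p mod 12 mod 4" by (simp_all add: mod_mod_cancel)
  note card = card_Ell_plus(2)[OF assms, unfolded cong_def this]
  have "card (Ell_plus p) = 2" if "[p = 1] (mod 12)"
    using that unfolding card cong_def by simp
  moreover have "card (Ell_plus p) = 1" if "[p = 5] (mod 12) \<or> [p = 7] (mod 12)"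
    using that unfolding card cong_def by auto
  moreover have "card (Ell_plus p) = 0" if "[p = 11] (mod 12)"
    using that unfolding card cong_def by simp
  ultimately show ?thesis
    using card_Ell_plus(1)[OF assms] Ell_minus_bij_reduced_forms[OF assms] by blast
qed

end
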